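(* Let $0<T_{\min}\le T_{\max}<\infty$ and $\gamma>0$. Consider the timer-dependent impulsive system $$\partial_\tau x(t_k+\tau)=A(\tau)x(t_k+\tau)+E_c(\tau)w_c(t_k+\tau),\ \tau\in(0,T_k],\ k\ge0;\qquad x(t_k^+)=Jx(t_k)+E_dw_d(k),\ k\ge1;$$ $$z_c(t_k+\tau)=C_c(\tau)x(t_k+\tau)+F_c(\tau)w_c(t_k+\tau),\ \tau\in(0,T_k],\ k\ge0;\qquad z_d(k)=C_dx(t_k)+F_dw_d(k),\ k\ge1;\qquad x(0)=x(0^+)=x_0,$$ and assume that it is internally positive. Then the following statements are equivalent: (a) There exists a vector $\lambda\in\mathbb{R}^n_{>0}$ such that $$(J\Phi(\theta,0)-I)\lambda+J\int_0^\theta\Phi(\theta,s)E_c(s)\mathbf 1\,ds+E_d\mathbf 1<0,$$ $$C_c(\tau)\left(\Phi(\tau,0)\lambda+\int_0^\tau\Phi(\tau,s)E_c(s)\mathbf 1\,ds\right)+F_c(\tau)\mathbf 1<\gamma\mathbf 1,$$ $$C_d\left(\Phi(\theta,0)\lambda+\int_0^\theta\Phi(\theta,s)E_c(s)\mathbf 1\,ds\right)+F_d\mathbf 1<\gamma\mathbf 1$$ hold for all $\tau\in[0,T_{\max}]$ and all $\theta\in[T_{\min},T_{\max}]$. (b) There exists a differentiable vector-valued function $\zeta:\mathbb{R}_{\ge0}\to\mathbb{R}^n$, $\zeta(0)>0$, such that $$-\dot\zeta(\tau)+A(\tau)\zeta(\tau)+E_c(\tau)\mathbf 1<0,\qquad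 C_c(\tau)\zeta(\tau)+F_c(\tau)\mathbf 1-\gamma\mathbf 1<0,$$ $$J\zeta(\theta)-\zeta(0)+E_d\mathbf 1<0,\qquad C_d\zeta(\theta)+F_d\mathbf 1-\gamma\mathbf 1<0$$ hold for all $\tau\in[0,T_{\max}]$ and $\theta\in[T_{\min},T_{\max}]$. (c) There exist a differentiable vector-valued function $\zeta:\mathbb{R}_{\ge0}\to\mathbb{R}^n$, $\zeta(0)>0$, and a vector-valued function $\mu:[T_{\min},T_{\max}]\to\mathbb{R}^n$ such that $$-\dot\zeta(\tau)+A(\tau)\zeta(\tau)+E_c(\tau)\mathbf 1<0,\qquad C_c(\tau)\zeta(\tau)+F_c(\tau)\mathbf 1-\gamma\mathbf 1<0,$$ $$\zeta(\theta)-\mu(\theta)\le0,\qquad J\mu(\theta)-\zeta(0)+E_d\mathbf 1<0,\qquad C_d\mu(\theta)+F_d\mathbf 1-\gamma\mathbf 1<0$$ hold for all $\tau\in[0,T_{\max}]$ and $\theta\in[T_{\min},T_{\max}]$. Moreover, if one of (a), (b), (c) holds, then the system is asymptotically stable under range dwell-time $[T_{\min},T_{\max}]$ and the hybrid $L_\infty\times\ell_\infty$-gain of the transfer $(w_c,w_d)\mapsto(z_c,z_d)$ is at most $\gamma$.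
   Context: Inequalities are componentwise; $\mathbf 1$ is the all-ones vector; $f(t^+)=\lim_{s\downarrow t}f(s)$; $x(t)\in\mathbb{R}^n$ and solutions are left-continuous. The functions $A,E_c,C_c,F_c$ are continuous and bounded matrix functions of the timer $\tau$; $J,E_d,C_d,F_d$ are constant. $T_k=t_{k+1}-t_k$. Internal positivity: $A(\tau)$ is Metzler (nonnegative off-diagonal entries) and $E_c(\tau),C_c(\tau),F_c(\tau),J,E_d,C_d,F_d$ are nonnegative. Range dwell-time $[T_{\min},T_{\max}]$ means that all impulse sequences with $t_0=0$ and $t_{k+1}-t_k\in[T_{\min},T_{\max}]$ for all $k\ge0$ are considered; stability refers to $w_c,w_d\equiv0$. $\Phi(t,s)$ is the state-transition matrix of $A(\cdot)$: $\partial_t\Phi(t,s)=A(t)\Phi(t,s)$, $\Phi(s,s)=I$. The hybrid $L_\infty\times\ell_\infty$-gain is the supremum of $\max\{\|z_c\|_{L_\infty},\|z_d\|_{\ell_\infty}\}$ over inputs with $\max\{\|w_c\|_{L_\infty},\|w_d\|_{\ell_\infty}\}=1$, $x_0=0$, and over all these impulse sequences (vector $\infty$-norm pointwise). *)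

theory Defs
  imports "HOL-Analysis.Analysis" "HOL-Probability.Essential_Supremum"
begin

text \<open>
  The library orders vectors and matrices entrywise by \<open>\<le>\<close>, but its \<open><\<close> on vectors only
  means \<open>x \<le> y \<and> \<not> y \<le> x\<close>; hence a separate strict componentwise relation.
\<close>

definition vec_less :: "real^'n \<Rightarrow> real^'n \<Rightarrow> bool"  (infix "<\<^sub>v" 50)
  where "x <\<^sub>v y \<longleftrightarrow> (\<forall>i. x $ i < y $ i)"

definition metzler :: "real^'n^'n \<Rightarrow> bool"
  where "metzler M \<longleftrightarrow> (\<forall>i j. i \<noteq> j \<longrightarrow> 0 \<le> M $ i $ j)"

text \<open>The timer ranges over \<open>[0, \<infinity>)\<close>, so derivatives at \<open>0\<close> are one-sided.\<close>

definition state_transition_matrix ::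
    "(real \<Rightarrow> real^'n^'n) \<Rightarrow> (real \<Rightarrow> real \<Rightarrow> real^'n^'n) \<Rightarrow> bool"
  where "state_transition_matrix A \<Phi> \<longleftrightarrow>
    (\<forall>s\<ge>0. \<Phi> s s = mat 1 \<and>
      (\<forall>t\<ge>0. ((\<lambda>r. \<Phi> r s) has_vector_derivative A t ** \<Phi> t s) (at t within {0..})))"

definition range_dwell_time :: "real \<Rightarrow> real \<Rightarrow> (nat \<Rightarrow> real) \<Rightarrow> bool"
  where "range_dwell_time Tmin Tmax t \<longleftrightarrow>
    t 0 = 0 \<and> (\<forall>k. t (Suc k) - t k \<in> {Tmin..Tmax})"

text \<open>
  Inputs are merely measurable in time, so the flow equation on \<open>(0, T\<^sub>k]\<close> is understood in the
  sense of Caratheodory, i.e. in integrated form. It makes \<open>x\<close> continuous on \<open>(t\<^sub>k, t\<^sub>k\<^sub>+\<^sub>1]\<close>, in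
  particular left-continuous at the impulse times; the jump conditions prescribe the right limits.
\<close>

definition impulsive_solution ::
    "(real \<Rightarrow> real^'n^'n) \<Rightarrow> (real \<Rightarrow> real^'pc^'n) \<Rightarrow> real^'n^'n \<Rightarrow> real^'pd^'n \<Rightarrow>
     (nat \<Rightarrow> real) \<Rightarrow> real^'n \<Rightarrow> (real \<Rightarrow> real^'pc) \<Rightarrow> (nat \<Rightarrow> real^'pd) \<Rightarrow>
     (real \<Rightarrow> real^'n) \<Rightarrow> bool"
  where "impulsive_solution A Ec J Ed t x0 wc wd x \<longleftrightarrow>
    x 0 = x0 \<and> (x \<longlongrightarrow> x0) (at_right 0) \<and>
    (\<forall>k\<ge>1. (x \<longlongrightarrow> J *v x (t k) + Ed *v wd k) (at_right (t k))) \<and>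
    (\<forall>k \<sigma> \<tau>. 0 < \<sigma> \<and> \<sigma> \<le> \<tau> \<and> \<tau> \<le> t (Suc k) - t k \<longrightarrow>
      ((\<lambda>s. A s *v x (t k + s) + Ec s *v wc (t k + s)) has_integral
        (x (t k + \<tau>) - x (t k + \<sigma>))) {\<sigma>..\<tau>})"

definition impulsive_output ::
    "(real \<Rightarrow> real^'n^'qc) \<Rightarrow> (real \<Rightarrow> real^'pc^'qc) \<Rightarrow> real^'n^'qd \<Rightarrow> real^'pd^'qd \<Rightarrow>
     (nat \<Rightarrow> real) \<Rightarrow> (real \<Rightarrow> real^'pc) \<Rightarrow> (nat \<Rightarrow> real^'pd) \<Rightarrow> (real \<Rightarrow> real^'n) \<Rightarrow>
     (real \<Rightarrow> real^'qc) \<Rightarrow> (nat \<Rightarrow> real^'qd) \<Rightarrow> bool"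
  where "impulsive_output Cc Fc Cd Fd t wc wd x zc zd \<longleftrightarrow>
    (\<forall>k \<tau>. 0 < \<tau> \<and> \<tau> \<le> t (Suc k) - t k \<longrightarrow>
      zc (t k + \<tau>) = Cc \<tau> *v x (t k + \<tau>) + Fc \<tau> *v wc (t k + \<tau>)) \<and>
    (\<forall>k\<ge>1. zd k = Cd *v x (t k) + Fd *v wd k)"

definition Linf_norm :: "(real \<Rightarrow> real^'m) \<Rightarrow> ereal"
  where "Linf_norm w = esssup (lebesgue_on {0..}) (\<lambda>t. ereal (infnorm (w t)))"

text \<open>Discrete signals are indexed by \<open>k \<ge> 1\<close>.\<close>

definition linf_norm :: "(nat \<Rightarrow> real^'m) \<Rightarrow> ereal"
  where "linf_norm w = (SUP k\<in>{1..}. ereal (infnorm (w k)))"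

text \<open>
  Stability of the zero solution of the unforced system together with attractivity, for each
  impulse sequence of the class; attractivity is global, which by linearity is the same as local.
\<close>

definition asymptotically_stable ::
    "real \<Rightarrow> real \<Rightarrow> (real \<Rightarrow> real^'n^'n) \<Rightarrow> (real \<Rightarrow> real^'pc^'n) \<Rightarrow> real^'n^'n \<Rightarrow>
     real^'pd^'n \<Rightarrow> bool"
  where "asymptotically_stable Tmin Tmax A Ec J Ed \<longleftrightarrow>
    (\<forall>t. range_dwell_time Tmin Tmax t \<longrightarrow>
      (\<forall>\<epsilon>>0. \<exists>\<delta>>0. \<forall>x0 x.
        norm x0 < \<delta> \<and> impulsive_solution A Ec J Ed t x0 (\<lambda>_. 0) (\<lambda>_. 0) x \<longrightarrow>
        (\<forall>s\<ge>0. norm (x s) < \<epsilon>)) \<and>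
      (\<forall>x0 x. impulsive_solution A Ec J Ed t x0 (\<lambda>_. 0) (\<lambda>_. 0) x \<longrightarrow>
        (x \<longlongrightarrow> 0) at_top))"

definition hybrid_gain ::
    "real \<Rightarrow> real \<Rightarrow> (real \<Rightarrow> real^'n^'n) \<Rightarrow> (real \<Rightarrow> real^'pc^'n) \<Rightarrow>
     (real \<Rightarrow> real^'n^'qc) \<Rightarrow> (real \<Rightarrow> real^'pc^'qc) \<Rightarrow>
     real^'n^'n \<Rightarrow> real^'pd^'n \<Rightarrow> real^'n^'qd \<Rightarrow> real^'pd^'qd \<Rightarrow> ereal"
  where "hybrid_gain Tmin Tmax A Ec Cc Fc J Ed Cd Fd =
    Sup {max (Linf_norm zc) (linf_norm zd) | zc zd. \<exists>t wc wd x.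
      range_dwell_time Tmin Tmax t \<and>
      wc \<in> borel_measurable (lebesgue_on {0..}) \<and>
      max (Linf_norm wc) (linf_norm wd) = 1 \<and>
      impulsive_solution A Ec J Ed t 0 wc wd x \<and>
      impulsive_output Cc Fc Cd Fd t wc wd x zc zd}"

end

theory Submission
  imports Defs
begin

text \<open>
  The whole argument rests on one positivity principle: if \<open>A\<close> is Metzler, then a trajectory of
  \<open>y' = A y + h\<close> with \<open>y(0) \<ge> 0\<close> and \<open>h \<ge> 0\<close> stays nonnegative
  (\<open>metzler_flow_nonneg\<close>). Equivalently, a trajectory that starts below a supersolution of the flow
  stays below it (\<open>metzler_comparison\<close>). It is proved for flows in integrated form, since inputs are
  only measurable.

  For (b) \<open>\<Longrightarrow>\<close> (a), a function \<open>\<zeta>\<close> as in (b) is a strict supersolution of the flow under the constant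
  input \<open>\<one>\<close>, so it dominates the response \<open>\<eta>\<close> to that input with \<open>\<eta>(0) = \<lambda> = \<zeta>(0)\<close>. The expressions
  in (a) are those of (b) with \<open>\<eta>\<close> in place of \<open>\<zeta>\<close>, and they are monotone because \<open>J\<close>, \<open>C\<^sub>c\<close> and
  \<open>C\<^sub>d\<close> are nonnegative. For (a) \<open>\<Longrightarrow>\<close> (b), the response \<open>\<eta>\<close> satisfies the flow condition only with
  equality. Adding \<open>\<epsilon> exp(L \<tau>) \<one>\<close> with \<open>L\<close> above all row sums of \<open>A\<close> makes it strict, and the other
  conditions survive for small \<open>\<epsilon>\<close> because they are strict on compact timer ranges
  (\<open>eventually_vec_less_perturbed\<close>). That \<open>\<eta>\<close> solves the forced equation
  (\<open>forced_response_derivative\<close>) requires \<open>\<Phi>(t,s) = \<Phi>(t,0) \<Phi>(0,s)\<close>, which again follows from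
  comparison. The equivalence of (b) and (c) is monotonicity, with \<open>\<mu> = \<zeta>\<close> in one direction.

  For the dynamic conclusions, \<open>\<zeta>\<close> serves as a vector-valued certificate that is restarted at each
  impulse. If \<open>\<bar>x\<bar> \<le> c \<zeta>(0)\<close> just after an impulse and the input is bounded by \<open>c\<close>, comparison gives
  \<open>\<bar>x\<bar> \<le> c \<zeta>(\<tau>)\<close> during the flow, and the jump condition returns the state below a multiple of
  \<open>\<zeta>(0)\<close> (\<open>upper_bound\<close>). Without input the jump condition gains a factor below \<open>1\<close> by compactness,
  whence exponential decay. With inputs bounded by \<open>1\<close> and zero initial state, \<open>\<bar>x\<bar> \<le> \<zeta>\<close> persists
  forever and the output conditions bound the outputs by \<open>\<gamma>\<close>.
\<close>

section \<open>Componentwise estimates\<close>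

lemma bounded_bilinear_matrix_vector_mult:
  "bounded_bilinear (\<lambda>(M::real^'n^'m) v. M *v v)"
proof -
  have "bilinear (\<lambda>(M::real^'n^'m) v. M *v v)"
    unfolding bilinear_def
    by (auto intro!: linearI simp: matrix_vector_mult_def vec_eq_iff algebra_simps
        sum.distrib sum_distrib_left)
  then show ?thesis
    using bilinear_conv_bounded_bilinear by blast
qed

lemmas continuous_on_matrix_vector_mult [continuous_intros] =
  bounded_bilinear.continuous_on[OF bounded_bilinear_matrix_vector_mult]

lemmas has_vector_derivative_matrix_vector_mult =
  bounded_bilinear.has_vector_derivative[OF bounded_bilinear_matrix_vector_mult]

lemmas matrix_vector_mult_minus_right =
  bounded_bilinear.minus_right[OF bounded_bilinear_matrix_vector_mult]

lemma measurable_matrix_vector_mult: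
  fixes M :: "'a \<Rightarrow> real^'n^'m"
  assumes "M \<in> borel_measurable S" and "v \<in> borel_measurable S"
  shows "(\<lambda>s. M s *v v s) \<in> borel_measurable S"
  by (rule borel_measurable_continuous_Pair[OF assms]) (intro continuous_intros)

lemma matrix_vector_mult_mono:
  fixes M :: "real^'n^'m"
  assumes "0 \<le> M" and "u \<le> v"
  shows "M *v u \<le> M *v v"
  using assms
  by (auto simp: less_eq_vec_def matrix_vector_mult_def intro!: sum_mono mult_left_mono)

lemma matrix_vector_mult_vec_less:
  fixes C :: "real^'n^'m"
  assumes "0 \<le> C" and "p \<le> q" and "C *v q + v <\<^sub>v 0"
  shows "C *v p + v <\<^sub>v 0"
  unfolding vec_less_def
proof
  fix i
  have "(C *v p) $ i \<le> (C *v q) $ i"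
    using matrix_vector_mult_mono[OF assms(1,2)] by (simp add: less_eq_vec_def)
  moreover have "(C *v q + v) $ i < 0 $ i"
    using assms(3) by (simp add: vec_less_def)
  ultimately show "(C *v p + v) $ i < 0 $ i"
    by simp
qed

lemma abs_matrix_vector_mult_le:
  fixes M :: "real^'n^'m"
  assumes "0 \<le> M" and "\<And>j. \<bar>u $ j\<bar> \<le> v $ j"
  shows "\<bar>(M *v u) $ i\<bar> \<le> (M *v v) $ i"
proof -
  have "\<bar>\<Sum>j\<in>UNIV. M $ i $ j * u $ j\<bar> \<le> (\<Sum>j\<in>UNIV. M $ i $ j * v $ j)"
    using assms by (intro order_trans[OF sum_abs] sum_mono)
      (auto simp: abs_mult less_eq_vec_def intro!: mult_mono)
  then show ?thesis
    by (simp add: matrix_vector_mult_def)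
qed

lemma infnorm_le_componentwise:
  fixes z :: "real^'m"
  assumes "\<And>i. \<bar>z $ i\<bar> \<le> b"
  shows "infnorm z \<le> b"
  unfolding infnorm_cart by (rule cSup_least) (use assms in auto)

lemma infnorm_output_le:
  fixes C :: "real^'n^'m" and F :: "real^'p^'m"
  assumes "0 \<le> C" and "0 \<le> F" and "\<And>i. \<bar>u $ i\<bar> \<le> p $ i" and "\<And>i. \<bar>v $ i\<bar> \<le> 1"
    and le: "C *v p + F *v 1 \<le> b *\<^sub>R 1"
  shows "infnorm (C *v u + F *v v) \<le> b"
proof (rule infnorm_le_componentwise)
  fix i
  have "\<bar>(C *v u) $ i\<bar> \<le> (C *v p) $ i" "\<bar>(F *v v) $ i\<bar> \<le> (F *v 1) $ i"
    using assms by (auto intro!: abs_matrix_vector_mult_le)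
  moreover have "(C *v p) $ i + (F *v 1) $ i \<le> b"
    using le by (simp add: less_eq_vec_def)
  ultimately show "\<bar>(C *v u + F *v v) $ i\<bar> \<le> b"
    unfolding vector_add_component by linarith
qed

lemma bounded_entries:
  fixes A :: "real \<Rightarrow> real^'n^'m"
  assumes "continuous_on K A" and "compact K"
  obtains B where "0 < B" and "\<And>s i j. s \<in> K \<Longrightarrow> \<bar>A s $ i $ j\<bar> \<le> B"
proof -
  have "bounded (A ` K)"
    using assms compact_continuous_image compact_imp_bounded by blast
  then obtain B where B: "0 < B" "\<And>s. s \<in> K \<Longrightarrow> norm (A s) \<le> B"
    using bounded_pos by (metis imageI)
  have "\<bar>A s $ i $ j\<bar> \<le> norm (A s)" for s i j
    by (metis Finite_Cartesian_Product.norm_nth_le order_trans real_norm_def)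
  then show thesis
    using B that by (meson order_trans)
qed

section \<open>Positivity and comparison for Metzler flows\<close>

lemma has_integral_nonneg_off_negligible:
  fixes f :: "real \<Rightarrow> real"
  assumes "(f has_integral I) S" and "negligible N" and "\<And>s. s \<in> S - N \<Longrightarrow> 0 \<le> f s"
  shows "0 \<le> I"
proof -
  have "((\<lambda>s. if s \<in> N then 0 else f s) has_integral I) S"
    by (rule has_integral_spike[OF assms(2) _ assms(1)]) auto
  then show ?thesis
    by (rule has_integral_nonneg) (use assms(3) in auto)
qed

text \<open>
  Let \<open>t\<close> be the first time at which some component \<open>z\<^sub>i\<close> fails to be positive. Shortly before \<open>t\<close> the
  \<open>i\<close>-th component of the integrand is nonnegative almost everywhere, so \<open>z\<^sub>i\<close> cannot have come down
  to a nonpositive value from a positive one. The uniform bound \<open>\<epsilon>\<close> on \<open>k\<close> is what beats the diagonal entry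
  of \<open>A\<close>, whose sign is arbitrary. Integrals are required only away from \<open>0\<close>: the argument lives near
  \<open>t > 0\<close>, and the flow equation of an impulsive solution is given on half-open intervals.
\<close>

lemma metzler_flow_pos:
  fixes A :: "real \<Rightarrow> real^'n^'n" and z k :: "real \<Rightarrow> real^'n"
  assumes contA: "continuous_on {0..T} A" and metz: "\<And>s. s \<in> {0..T} \<Longrightarrow> metzler (A s)"
    and contz: "continuous_on {0..T} z" and z0: "0 <\<^sub>v z 0"
    and flow: "\<And>\<sigma> \<tau>. 0 < \<sigma> \<Longrightarrow> \<sigma> \<le> \<tau> \<Longrightarrow> \<tau> \<le> T \<Longrightarrow>
      ((\<lambda>s. A s *v z s + k s) has_integral (z \<tau> - z \<sigma>)) {\<sigma>..\<tau>}"
    and N: "negligible N" and "0 < \<epsilon>" and k: "\<And>s i. s \<in> {0<..T} - N \<Longrightarrow> \<epsilon> \<le> k s $ i"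
    and \<tau>: "\<tau> \<in> {0..T}"
  shows "0 <\<^sub>v z \<tau>"
proof (rule ccontr)
  assume neg: "\<not> 0 <\<^sub>v z \<tau>"
  define S where "S = (\<Union>i. {s \<in> {0..T}. z s $ i \<le> 0})"
  have "closed {s \<in> {0..T}. z s $ i \<le> 0}" for i
    by (intro continuous_on_closed_Collect_le continuous_intros contz)
  then have "closed S"
    unfolding S_def by (auto intro!: closed_UN)
  moreover have "S \<noteq> {}"
    using neg \<tau> by (auto simp: S_def vec_less_def not_less)
  moreover have "bdd_below S"
    by (auto simp: S_def intro!: bdd_belowI[of _ 0])
  ultimately have "Inf S \<in> S" and "bdd_below S"
    by (auto intro!: closed_contains_Inf)
  define t where "t = Inf S"
  obtain i where t: "0 \<le> t" "t \<le> T" "z t $ i \<le> 0"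
    using \<open>Inf S \<in> S\<close> by (auto simp: S_def t_def)
  have "0 < t"
    using z0 t by (cases "t = 0") (auto simp: vec_less_def not_less[symmetric])
  have pos: "0 < z s $ j" if "0 \<le> s" "s < t" for s j
  proof (rule ccontr)
    assume "\<not> 0 < z s $ j"
    then have "s \<in> S"
      using that t by (auto simp: S_def not_less)
    then show False
      using cInf_lower[OF _ \<open>bdd_below S\<close>] that by (force simp: t_def)
  qed
  obtain B where "0 < B" and B: "\<And>s i j. s \<in> {0..T} \<Longrightarrow> \<bar>A s $ i $ j\<bar> \<le> B"
    using bounded_entries[OF contA compact_Icc] by metis
  \<comment> \<open>The off-diagonal terms of \<open>A z\<close> are nonnegative up to \<open>t\<close>, so only the diagonal term can be
    negative. It is at least \<open>- B z\<^sub>i\<close>, hence dominated by \<open>\<epsilon>\<close> once \<open>z\<^sub>i\<close> is close to its zero.\<close>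
  have "continuous (at t within {0..T}) (\<lambda>s. z s $ i)"
    using contz t by (intro continuous_intros) (auto simp: continuous_on_eq_continuous_within)
  moreover have "z t $ i < \<epsilon> / B"
    using t \<open>0 < B\<close> \<open>0 < \<epsilon>\<close> by (smt (verit) divide_pos_pos)
  ultimately have "\<forall>\<^sub>F s in at t within {0..T}. z s $ i < \<epsilon> / B"
    unfolding continuous_within by (rule order_tendstoD)
  then obtain d where d: "d > 0" "\<And>s. s \<in> {0..T} \<Longrightarrow> s \<noteq> t \<Longrightarrow> dist s t < d \<Longrightarrow> z s $ i < \<epsilon> / B"
    unfolding eventually_at by blast
  \<comment> \<open>Halving keeps \<open>\<sigma>\<close> strictly positive and strictly within distance \<open>d\<close> of \<open>t\<close>.\<close>
  define \<sigma> where "\<sigma> = max (t / 2) (t - d / 2)"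
  have \<sigma>: "0 < \<sigma>" "\<sigma> < t" "t - \<sigma> < d"
    using \<open>0 < t\<close> \<open>d > 0\<close> by (auto simp: \<sigma>_def max_def)
  have "((\<lambda>s. (A s *v z s + k s) $ i) has_integral ((z t - z \<sigma>) $ i)) {\<sigma>..t}"
    using has_integral_linear[OF flow[OF \<sigma>(1) _ t(2)] bounded_linear_vec_nth] \<sigma>
    by (auto simp: o_def)
  moreover have "negligible (insert t N)"
    using N by simp
  ultimately have "0 \<le> (z t - z \<sigma>) $ i"
  proof (rule has_integral_nonneg_off_negligible)
    fix s assume s: "s \<in> {\<sigma>..t} - insert t N"
    then have s': "s \<in> {0..T}" "0 < s" "s < t" "s \<notin> N"
      using \<sigma> t by auto
    have zs: "z s $ i < \<epsilon> / B" "0 < z s $ i"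
      using d(2)[OF s'(1)] s s' \<sigma> pos[of s i] by (auto simp: dist_real_def)
    have "0 \<le> (\<Sum>j\<in>UNIV - {i}. A s $ i $ j * z s $ j)"
      using metz[OF s'(1)] pos[of s] s'
      by (intro sum_nonneg mult_nonneg_nonneg) (auto simp: metzler_def less_imp_le)
    moreover have "(A s *v z s) $ i = A s $ i $ i * z s $ i + (\<Sum>j\<in>UNIV - {i}. A s $ i $ j * z s $ j)"
      by (simp add: matrix_vector_mult_def sum.remove[of UNIV i])
    moreover have "- (B * z s $ i) \<le> A s $ i $ i * z s $ i"
      using B[OF s'(1), of i i] zs mult_right_mono[of "-B" "A s $ i $ i" "z s $ i"] by auto
    moreover have "B * z s $ i < \<epsilon>"
      using zs \<open>0 < B\<close> by (simp add: field_simps)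
    moreover have "\<epsilon> \<le> k s $ i"
      using k s' t by auto
    ultimately show "0 \<le> (A s *v z s + k s) $ i"
      by auto
  qed
  then show False
    using pos[of \<sigma> i] \<sigma> t by auto
qed

text \<open>
  This is the perturbation that turns weak inequalities into strict ones: once \<open>L\<close> exceeds every row
  sum of \<open>A\<close> by at least \<open>1\<close>, the function \<open>exp(L s) \<one>\<close> is a supersolution of \<open>v' = A v\<close> with a margin
  that is uniform in time.
\<close>

lemma exp_supersolution:
  fixes A :: "real \<Rightarrow> real^'n^'n"
  assumes "continuous_on {0..T} A"
  obtains L where "\<And>s i. s \<in> {0..T} \<Longrightarrow> 1 \<le> (exp (L * s) *\<^sub>R (L *\<^sub>R 1 - A s *v 1)) $ i"
proof -
  obtain B where "0 < B" and B: "\<And>s i j. s \<in> {0..T} \<Longrightarrow> \<bar>A s $ i $ j\<bar> \<le> B"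
    using bounded_entries[OF assms compact_Icc] by metis
  define L where "L = 1 + CARD('n) * B"
  have "1 \<le> exp (L * s) * (L - (A s *v 1) $ i)" if "s \<in> {0..T}" for s i
  proof -
    have "(\<Sum>j\<in>UNIV. A s $ i $ j) \<le> (\<Sum>j\<in>(UNIV::'n set). B)"
      using B[OF that, of i] by (intro sum_mono) (auto simp: abs_le_iff)
    then have "1 \<le> L - (A s *v 1) $ i"
      by (simp add: L_def matrix_vector_mult_def)
    moreover have "1 \<le> exp (L * s)"
      using \<open>0 < B\<close> that by (auto simp: L_def)
    ultimately show ?thesis
      by (metis mult_mono' mult_1 zero_le_one)
  qed
  then show thesis
    by (intro that[of L]) auto
qed

lemma has_vector_derivative_exp_ones:
  "((\<lambda>s. exp (L * s) *\<^sub>R (1::real^'n)) has_vector_derivative (exp (L * s) *\<^sub>R (L *\<^sub>R 1))) (at s within S)"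
  by (auto intro!: derivative_eq_intros has_vector_derivative_scaleR
      simp: has_real_derivative_iff_has_vector_derivative[symmetric] mult.commute)

text \<open>
  Adding \<open>\<epsilon> exp(L s) \<one>\<close> reduces the weak statement to \<open>metzler_flow_pos\<close>; then \<open>\<epsilon>\<close> tends to \<open>0\<close>.
\<close>

lemma metzler_flow_nonneg:
  fixes A :: "real \<Rightarrow> real^'n^'n" and y h :: "real \<Rightarrow> real^'n"
  assumes contA: "continuous_on {0..T} A" and metz: "\<And>s. s \<in> {0..T} \<Longrightarrow> metzler (A s)"
    and conty: "continuous_on {0..T} y" and y0: "0 \<le> y 0"
    and flow: "\<And>\<sigma> \<tau>. 0 < \<sigma> \<Longrightarrow> \<sigma> \<le> \<tau> \<Longrightarrow> \<tau> \<le> T \<Longrightarrow>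
      ((\<lambda>s. A s *v y s + h s) has_integral (y \<tau> - y \<sigma>)) {\<sigma>..\<tau>}"
    and N: "negligible N" and h: "\<And>s. s \<in> {0<..T} - N \<Longrightarrow> 0 \<le> h s"
    and \<tau>: "\<tau> \<in> {0..T}"
  shows "0 \<le> y \<tau>"
proof -
  obtain L where L: "\<And>s i. s \<in> {0..T} \<Longrightarrow> 1 \<le> (exp (L * s) *\<^sub>R (L *\<^sub>R 1 - A s *v 1)) $ i"
    using exp_supersolution[OF contA] by metis
  define \<xi> :: "real \<Rightarrow> real^'n" where "\<xi> s = exp (L * s) *\<^sub>R 1" for s
  have pos: "0 <\<^sub>v y \<tau> + \<epsilon> *\<^sub>R \<xi> \<tau>" if "0 < \<epsilon>" for \<epsilon>
  proof (rule metzler_flow_pos[OF contA metz])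
    show "continuous_on {0..T} (\<lambda>s. y s + \<epsilon> *\<^sub>R \<xi> s)"
      unfolding \<xi>_def by (intro continuous_intros conty)
    show "0 <\<^sub>v y 0 + \<epsilon> *\<^sub>R \<xi> 0"
      using y0 that by (auto simp: vec_less_def less_eq_vec_def \<xi>_def intro: add_nonneg_pos)
    show "\<epsilon> \<le> (h s + \<epsilon> *\<^sub>R (exp (L * s) *\<^sub>R (L *\<^sub>R 1 - A s *v 1))) $ i"
      if "s \<in> {0<..T} - N" for s i
    proof -
      have "\<epsilon> * 1 \<le> \<epsilon> * (exp (L * s) *\<^sub>R (L *\<^sub>R 1 - A s *v 1)) $ i"
        using L[of s i] that \<open>0 < \<epsilon>\<close> by (intro mult_left_mono) auto
      moreover have "0 \<le> h s $ i"
        using h[OF that] by (simp add: less_eq_vec_def)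
      ultimately show ?thesis
        by simp
    qed
    fix \<sigma> \<tau> assume st: "0 < \<sigma>" "\<sigma> \<le> \<tau>" "\<tau> \<le> T"
    have "((\<lambda>s. exp (L * s) *\<^sub>R (L *\<^sub>R 1)) has_integral \<xi> \<tau> - \<xi> \<sigma>) {\<sigma>..\<tau>}"
      unfolding \<xi>_def
      by (intro fundamental_theorem_of_calculus st has_vector_derivative_exp_ones)
    from has_integral_add[OF flow[OF st] has_integral_cmul[OF this, of \<epsilon>]]
    show "((\<lambda>s. A s *v (y s + \<epsilon> *\<^sub>R \<xi> s)
        + (h s + \<epsilon> *\<^sub>R (exp (L * s) *\<^sub>R (L *\<^sub>R 1 - A s *v 1))))
      has_integral (y \<tau> + \<epsilon> *\<^sub>R \<xi> \<tau> - (y \<sigma> + \<epsilon> *\<^sub>R \<xi> \<sigma>))) {\<sigma>..\<tau>}"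
      by (simp add: \<xi>_def algebra_simps matrix_vector_right_distrib matrix_vector_mult_scaleR)
  qed (use N that \<tau> in auto)
  have "0 \<le> y \<tau> $ i" for i
  proof (rule field_le_epsilon)
    fix e :: real assume "0 < e"
    \<comment> \<open>This \<open>\<epsilon>\<close> makes the perturbation equal to \<open>e\<close> at time \<open>\<tau>\<close>.\<close>
    then show "0 \<le> y \<tau> $ i + e"
      using pos[of "e / exp (L * \<tau>)"] by (auto simp: vec_less_def \<xi>_def less_imp_le)
  qed
  then show ?thesis
    by (simp add: less_eq_vec_def)
qed

lemma continuous_on_flow:
  fixes x f :: "real \<Rightarrow> 'a::banach"
  assumes flow: "\<And>\<sigma> \<tau>. 0 < \<sigma> \<Longrightarrow> \<sigma> \<le> \<tau> \<Longrightarrow> \<tau> \<le> T \<Longrightarrow> (f has_integral (x \<tau> - x \<sigma>)) {\<sigma>..\<tau>}"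
  shows "continuous_on {0<..T} x"
proof -
  have "continuous (at s within {0<..T}) x" if s: "0 < s" "s \<le> T" for s
  proof -
    have "f integrable_on {s/2..T}"
      using flow[of "s / 2" T] s by auto
    then have "continuous_on {s/2..T} (\<lambda>r. x (s/2) + integral {s/2..r} f)"
      by (intro continuous_intros indefinite_integral_continuous_1)
    moreover have "x (s/2) + integral {s/2..r} f = x r" if "r \<in> {s/2..T}" for r
      using flow[of "s / 2" r] that s by (auto dest!: integral_unique)
    ultimately have "continuous_on {s/2..T} x"
      by (rule continuous_on_eq)
    then have "continuous (at s within {s/2..T}) x"
      using s by (auto simp: continuous_on_eq_continuous_within)
    moreover have "at s within {s/2..T} = at s within {0<..T}"
      by (rule at_within_nhd[of _ "{s/2<..}"]) (use s in auto)
    ultimately show ?thesis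
      by simp
  qed
  then show ?thesis
    by (simp add: continuous_on_eq_continuous_within)
qed

text \<open>
  The difference \<open>\<zeta> - x\<close> is a flow with nonnegative forcing. The derivative \<open>\<zeta>'\<close> need not be
  continuous, nor even Lebesgue integrable, but it is Henstock--Kurzweil integrable by the fundamental theorem
  of calculus, which is all that the integrated form uses. The exceptional set \<open>N\<close> absorbs the times
  at which an essentially bounded input exceeds its bound.
\<close>

lemma metzler_comparison:
  fixes A :: "real \<Rightarrow> real^'n^'n" and x g \<zeta> \<zeta>' :: "real \<Rightarrow> real^'n"
  assumes contA: "continuous_on {0..T} A" and metz: "\<And>s. s \<in> {0..T} \<Longrightarrow> metzler (A s)"
    and flow: "\<And>\<sigma> \<tau>. 0 < \<sigma> \<Longrightarrow> \<sigma> \<le> \<tau> \<Longrightarrow> \<tau> \<le> T \<Longrightarrow>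
      ((\<lambda>s. A s *v x s + g s) has_integral (x \<tau> - x \<sigma>)) {\<sigma>..\<tau>}"
    and lim: "(x \<longlongrightarrow> a) (at_right 0)" and a: "a \<le> \<zeta> 0"
    and der: "\<And>s. s \<in> {0..T} \<Longrightarrow> (\<zeta> has_vector_derivative \<zeta>' s) (at s within {0..T})"
    and N: "negligible N" and super: "\<And>s. s \<in> {0<..T} - N \<Longrightarrow> A s *v \<zeta> s + g s \<le> \<zeta>' s"
    and \<tau>: "\<tau> \<in> {0<..T}"
  shows "x \<tau> \<le> \<zeta> \<tau>"
proof -
  \<comment> \<open>After an impulse the trajectory starts from its right limit, which may differ from \<open>x 0\<close>.\<close>
  define X where "X s = (if s = 0 then a else x s)" for s
  have cont\<zeta>: "continuous_on {0..T} \<zeta>"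
    using der by (meson continuous_on_eq_continuous_within has_vector_derivative_continuous)
  have "continuous (at s within {0..T}) X" if s: "s \<in> {0..T}" for s
  proof (cases "s = 0")
    case True
    have "(X \<longlongrightarrow> a) (at_right 0)"
      by (rule Lim_transform_eventually[OF lim]) (auto simp: X_def eventually_at_filter)
    moreover have "at 0 within {0..T} \<le> at_right (0::real)"
      by (auto simp: le_filter_def eventually_at_filter elim!: eventually_mono)
    ultimately show ?thesis
      using True by (auto simp: continuous_within X_def intro: tendsto_mono)
  next
    case False
    have "continuous_on {0<..T} X"
      using continuous_on_flow[OF flow] by (rule continuous_on_eq) (auto simp: X_def)
    then have "continuous (at s within {0<..T}) X"
      using s False by (auto simp: continuous_on_eq_continuous_within)
    moreover have "at s within {0<..T} = at s within {0..T}"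
      by (rule at_within_nhd[of _ "{0<..}"]) (use s False in auto)
    ultimately show ?thesis
      by simp
  qed
  then have contX: "continuous_on {0..T} X"
    by (simp add: continuous_on_eq_continuous_within)
  have "0 \<le> \<zeta> \<tau> - X \<tau>"
  proof (rule metzler_flow_nonneg[OF contA metz, where h = "\<lambda>s. \<zeta>' s - A s *v \<zeta> s - g s"])
    show "continuous_on {0..T} (\<lambda>s. \<zeta> s - X s)"
      by (intro continuous_intros cont\<zeta> contX)
    show "0 \<le> \<zeta> 0 - X 0"
      using a by (auto simp: X_def less_eq_vec_def)
    show "0 \<le> \<zeta>' s - A s *v \<zeta> s - g s" if "s \<in> {0<..T} - N" for s
      using super[OF that] by (auto simp: less_eq_vec_def algebra_simps)
    fix \<sigma> \<tau> assume st: "0 < \<sigma>" "\<sigma> \<le> \<tau>" "\<tau> \<le> T"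
    have "(\<zeta>' has_integral (\<zeta> \<tau> - \<zeta> \<sigma>)) {\<sigma>..\<tau>}"
      by (rule fundamental_theorem_of_calculus[OF st(2)])
        (use st in \<open>auto intro!: has_vector_derivative_within_subset[OF der]\<close>)
    then have "((\<lambda>s. \<zeta>' s - (A s *v x s + g s)) has_integral (\<zeta> \<tau> - X \<tau> - (\<zeta> \<sigma> - X \<sigma>))) {\<sigma>..\<tau>}"
      using has_integral_diff[OF _ flow[OF st]] st by (fastforce simp: X_def algebra_simps)
    then show "((\<lambda>s. A s *v (\<zeta> s - X s) + (\<zeta>' s - A s *v \<zeta> s - g s)) has_integral
        (\<zeta> \<tau> - X \<tau> - (\<zeta> \<sigma> - X \<sigma>))) {\<sigma>..\<tau>}"
      by (rule has_integral_eq[rotated])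
        (use st in \<open>auto simp: X_def matrix_vector_mult_diff_distrib\<close>)
  qed (use N \<tau> in auto)
  then show ?thesis
    using \<tau> by (auto simp: X_def less_eq_vec_def)
qed

text \<open>
  Uniqueness for the linear equation, by comparing both \<open>v\<close> and \<open>- v\<close> with the zero trajectory.
\<close>

lemma linear_flow_zero:
  fixes A :: "real \<Rightarrow> real^'n^'n" and v :: "real \<Rightarrow> real^'n"
  assumes contA: "continuous_on {0..T} A" and metz: "\<And>s. s \<in> {0..T} \<Longrightarrow> metzler (A s)"
    and der: "\<And>s. s \<in> {0..T} \<Longrightarrow> (v has_vector_derivative A s *v v s) (at s within {0..T})"
    and v0: "v 0 = 0" and \<tau>: "\<tau> \<in> {0..T}"
  shows "v \<tau> = 0"
proof (cases "\<tau> = 0")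
  case False
  have lower: "0 \<le> u \<tau>"
    if "\<And>s. s \<in> {0..T} \<Longrightarrow> (u has_vector_derivative A s *v u s) (at s within {0..T})" "u 0 = 0"
    for u :: "real \<Rightarrow> real^'n"
    by (rule metzler_comparison[OF contA metz, where x = "\<lambda>_. 0" and g = "\<lambda>_. 0" and a = 0 and N = "{}"])
      (use that \<tau> False in auto)
  have "0 \<le> v \<tau>"
    using der v0 by (rule lower)
  moreover have "0 \<le> - v \<tau>"
  proof (rule lower[where u = "\<lambda>s. - v s"])
    show "((\<lambda>s. - v s) has_vector_derivative A s *v - v s) (at s within {0..T})" if "s \<in> {0..T}" for s
      using has_vector_derivative_minus[OF der[OF that]]
      by (simp add: matrix_vector_mult_minus_right)
  qed (use v0 in simp)
  ultimately show ?thesis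
    by (auto simp: less_eq_vec_def vec_eq_iff intro: antisym)
qed (use v0 in simp)

section \<open>The forced response\<close>

text \<open>
  As functions of \<open>t\<close> both sides solve the same linear equation, and they agree at \<open>t = 0\<close>. The case
  \<open>t = s\<close> exhibits \<open>\<Phi> 0 s\<close> as the inverse of \<open>\<Phi> s 0\<close>.
\<close>

lemma state_transition_cocycle:
  fixes A :: "real \<Rightarrow> real^'n^'n"
  assumes st: "state_transition_matrix A \<Phi>"
    and contA: "continuous_on {0..} A" and metz: "\<And>s. 0 \<le> s \<Longrightarrow> metzler (A s)"
    and "0 \<le> s" "0 \<le> t"
  shows "\<Phi> t s *v c = \<Phi> t 0 *v (\<Phi> 0 s *v c)"
proof -
  have der: "((\<lambda>r. \<Phi> r p *v d) has_vector_derivative A r *v (\<Phi> r p *v d)) (at r within {0..t})"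
    if "0 \<le> p" "r \<in> {0..t}" for p r d
  proof -
    have "((\<lambda>r. \<Phi> r p) has_vector_derivative A r ** \<Phi> r p) (at r within {0..t})"
      using st that unfolding state_transition_matrix_def
      by (auto intro: has_vector_derivative_within_subset[of _ _ _ "{0..}"])
    from has_vector_derivative_matrix_vector_mult[OF this has_vector_derivative_const[of d]]
    show ?thesis
      by (simp add: matrix_vector_mul_assoc)
  qed
  let ?v = "\<lambda>r. \<Phi> r s *v c - \<Phi> r 0 *v (\<Phi> 0 s *v c)"
  have "?v t = 0"
  proof (rule linear_flow_zero[where A = A and T = t and v = ?v])
    show "continuous_on {0..t} A"
      using contA by (rule continuous_on_subset) auto
    show "?v 0 = 0"
      using st by (simp add: state_transition_matrix_def)
    show "(?v has_vector_derivative A r *v ?v r) (at r within {0..t})" if "r \<in> {0..t}" for r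
      using has_vector_derivative_diff[OF der[OF \<open>0 \<le> s\<close> that] der[OF order_refl that]]
      by (simp add: matrix_vector_mult_diff_distrib)
  qed (use metz \<open>0 \<le> t\<close> in auto)
  then show ?thesis
    by simp
qed

lemma continuous_on_det:
  fixes M :: "'a::topological_space \<Rightarrow> real^'n^'n"
  assumes "\<And>i j. continuous_on S (\<lambda>s. M s $ i $ j)"
  shows "continuous_on S (\<lambda>s. det (M s))"
  unfolding det_def by (intro continuous_intros assms)

text \<open>
  By Cramer's rule the solution is a rational expression in the data with nonvanishing denominator.
\<close>

lemma continuous_on_linear_solve:
  fixes U :: "'a::topological_space \<Rightarrow> real^'n^'n"
  assumes U: "continuous_on S U" and b: "continuous_on S b"
    and det: "\<And>s. s \<in> S \<Longrightarrow> det (U s) \<noteq> 0" and sol: "\<And>s. s \<in> S \<Longrightarrow> U s *v c s = b s"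
  shows "continuous_on S c"
proof -
  have "continuous_on S (\<lambda>s. \<chi> k. det (\<chi> i j. if j = k then b s $ i else U s $ i $ j) / det (U s))"
  proof (intro continuous_on_vec_lambda continuous_on_divide continuous_on_det)
    show "continuous_on S (\<lambda>s. (\<chi> i j. if j = k then b s $ i else U s $ i $ j) $ i $ j)" for k i j
      by (cases "j = k") (auto intro!: continuous_intros U b)
  qed (use det U in \<open>auto intro!: continuous_intros\<close>)
  then show ?thesis
    by (rule continuous_on_eq) (rule cramer[THEN iffD1, OF det sol, symmetric])
qed

definition forced_response ::
    "(real \<Rightarrow> real \<Rightarrow> real^'n^'n) \<Rightarrow> (real \<Rightarrow> real^'n) \<Rightarrow> real^'n \<Rightarrow> real \<Rightarrow> real^'n"
  where "forced_response \<Phi> u l t = \<Phi> t 0 *v l + integral {0..t} (\<lambda>s. \<Phi> t s *v u s)"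

lemma forced_response_0:
  assumes "state_transition_matrix A \<Phi>"
  shows "forced_response \<Phi> u l 0 = l"
  using assms by (simp add: forced_response_def state_transition_matrix_def)

text \<open>
  The cocycle identity moves the dependence on \<open>t\<close> out of the integral, which leaves
  \<open>\<Phi> t 0 (l + \<integral> \<Phi> 0 s u(s) ds)\<close>, and the product rule applies.
\<close>

lemma forced_response_derivative:
  fixes A :: "real \<Rightarrow> real^'n^'n" and u :: "real \<Rightarrow> real^'n"
  assumes st: "state_transition_matrix A \<Phi>"
    and contA: "continuous_on {0..} A" and metz: "\<And>s. 0 \<le> s \<Longrightarrow> metzler (A s)"
    and contu: "continuous_on {0..} u"
    and t: "0 \<le> t"
  shows "(forced_response \<Phi> u l has_vector_derivative A t *v forced_response \<Phi> u l t + u t)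
    (at t within {0..})"
proof -
  define \<eta> where "\<eta> = forced_response \<Phi> u l"
  define c where "c s = \<Phi> 0 s *v u s" for s
  note cocycle = state_transition_cocycle[OF st contA metz]
  have der: "((\<lambda>r. \<Phi> r 0) has_vector_derivative A r ** \<Phi> r 0) (at r within {0..})" if "0 \<le> r" for r
    using st that by (simp add: state_transition_matrix_def)
  have id: "\<Phi> s 0 *v (\<Phi> 0 s *v d) = d" if "0 \<le> s" for s d
    using st that cocycle[of s s d] by (simp add: state_transition_matrix_def)
  \<comment> \<open>The hypotheses say nothing on the dependence of \<open>\<Phi> t s\<close> on \<open>s\<close>; continuity of \<open>c\<close> comes from
    solving \<open>\<Phi> s 0 c(s) = u(s)\<close>.\<close>
  have contc: "continuous_on {0..} c"
  proof (rule continuous_on_linear_solve[OF _ contu])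
    show "continuous_on {0..} (\<lambda>s. \<Phi> s 0)"
      using der by (meson atLeast_iff continuous_on_eq_continuous_within has_vector_derivative_continuous)
    show "\<Phi> s 0 *v c s = u s" if "s \<in> {0..}" for s
      using id that by (simp add: c_def)
    show "det (\<Phi> s 0) \<noteq> 0" if "s \<in> {0..}" for s
    proof -
      have "\<Phi> s 0 ** \<Phi> 0 s = mat 1"
        using id[of s] that by (simp add: matrix_eq flip: matrix_vector_mul_assoc)
      then show ?thesis
        by (metis det_I det_mul mult_zero_left zero_neq_one)
    qed
  qed
  have \<eta>: "\<eta> r = \<Phi> r 0 *v (l + integral {0..r} c)" if "0 \<le> r" for r
  proof -
    have "integral {0..r} (\<lambda>s. \<Phi> r s *v u s) = integral {0..r} (\<lambda>s. \<Phi> r 0 *v c s)"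
      unfolding c_def by (intro integral_cong cocycle) (use that in auto)
    also have "\<dots> = \<Phi> r 0 *v integral {0..r} c"
      using integral_linear[OF integrable_continuous_real matrix_vector_mul_bounded_linear]
        continuous_on_subset[OF contc, of "{0..r}"] by (auto simp: o_def)
    finally show ?thesis
      by (simp add: \<eta>_def forced_response_def matrix_vector_right_distrib)
  qed
  have "((\<lambda>r. integral {0..r} c) has_vector_derivative c t) (at t within {0..t + 1})"
    using t by (intro integral_has_vector_derivative continuous_on_subset[OF contc]) auto
  moreover have "at t within {0..t + 1} = at t within {0..}"
    by (rule at_within_nhd[of _ "{..<t + 1}"]) auto
  ultimately have "((\<lambda>r. l + integral {0..r} c) has_vector_derivative c t) (at t within {0..})"
    using has_vector_derivative_add[OF has_vector_derivative_const[of l]] by fastforce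
  from has_vector_derivative_matrix_vector_mult[OF der[OF t] this]
  have "((\<lambda>r. \<Phi> r 0 *v (l + integral {0..r} c)) has_vector_derivative A t *v \<eta> t + u t) (at t within {0..})"
    using id[OF t, of "u t"] \<eta>[OF t]
    by (simp add: c_def add.commute flip: matrix_vector_mul_assoc)
  then show ?thesis
    unfolding \<eta>_def[symmetric]
    by (rule has_vector_derivative_transform[rotated 2]) (use \<eta> t in auto)
qed

lemma forced_response_le_supersolution:
  fixes A :: "real \<Rightarrow> real^'n^'n" and u \<zeta> \<zeta>' :: "real \<Rightarrow> real^'n"
  assumes st: "state_transition_matrix A \<Phi>"
    and contA: "continuous_on {0..} A" and metz: "\<And>s. 0 \<le> s \<Longrightarrow> metzler (A s)"
    and contu: "continuous_on {0..} u"
    and der: "\<And>s. s \<in> {0..T} \<Longrightarrow> (\<zeta> has_vector_derivative \<zeta>' s) (at s within {0..T})"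
    and super: "\<And>s. s \<in> {0..T} \<Longrightarrow> A s *v \<zeta> s + u s \<le> \<zeta>' s"
    and \<tau>: "\<tau> \<in> {0..T}"
  shows "forced_response \<Phi> u (\<zeta> 0) \<tau> \<le> \<zeta> \<tau>"
proof (cases "\<tau> = 0")
  case True
  then show ?thesis
    using forced_response_0[OF st] by simp
next
  case False
  define \<eta> where "\<eta> = forced_response \<Phi> u (\<zeta> 0)"
  have der\<eta>: "(\<eta> has_vector_derivative A s *v \<eta> s + u s) (at s within {0..})" if "0 \<le> s" for s
    unfolding \<eta>_def by (rule forced_response_derivative[OF st contA metz contu that])
  have "\<eta> \<tau> \<le> \<zeta> \<tau>"
  proof (rule metzler_comparison[where T = T and A = A and g = u and N = "{}"])
    show "continuous_on {0..T} A"
      using contA by (rule continuous_on_subset) auto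
    show "((\<lambda>s. A s *v \<eta> s + u s) has_integral \<eta> \<tau> - \<eta> \<sigma>) {\<sigma>..\<tau>}"
      if "0 < \<sigma>" "\<sigma> \<le> \<tau>" for \<sigma> \<tau>
      using that
      by (auto intro!: fundamental_theorem_of_calculus has_vector_derivative_within_subset[OF der\<eta>])
    have "(\<eta> \<longlongrightarrow> \<eta> 0) (at 0 within {0..})"
      using has_vector_derivative_continuous[OF der\<eta>] by (simp add: continuous_within)
    then show "(\<eta> \<longlongrightarrow> \<zeta> 0) (at_right 0)"
      using forced_response_0[OF st, of u "\<zeta> 0"]
      by (auto simp: \<eta>_def intro: tendsto_within_subset)
  qed (use metz der super \<tau> False in auto)
  then show ?thesis
    by (simp add: \<eta>_def)
qed

section \<open>Strict inequalities on compact sets\<close>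

text \<open>
  On a compact set each component of \<open>f\<close> has a negative maximum and each component of \<open>g\<close> is bounded
  above, so one \<open>\<epsilon>\<close> serves all points at once.
\<close>

lemma eventually_vec_less_perturbed:
  fixes f g :: "real \<Rightarrow> real^'m"
  assumes f: "continuous_on K f" and g: "continuous_on K g" and K: "compact K"
    and neg: "\<And>\<theta>. \<theta> \<in> K \<Longrightarrow> f \<theta> <\<^sub>v 0"
  shows "\<forall>\<^sub>F \<epsilon> in at_right 0. \<forall>\<theta>\<in>K. f \<theta> + \<epsilon> *\<^sub>R g \<theta> <\<^sub>v 0"
proof (cases "K = {}")
  case False
  have "\<forall>\<^sub>F \<epsilon> in at_right 0. \<forall>\<theta>\<in>K. f \<theta> $ i + \<epsilon> * g \<theta> $ i < 0" for i
  proof -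
    have "continuous_on K (\<lambda>\<theta>. f \<theta> $ i)" and g_cont: "continuous_on K (\<lambda>\<theta>. g \<theta> $ i)"
      using f g by (auto intro!: continuous_intros)
    then obtain p where p: "p \<in> K" "\<And>\<theta>. \<theta> \<in> K \<Longrightarrow> f \<theta> $ i \<le> f p $ i"
      using continuous_attains_sup[OF K False] by blast
    obtain q where q: "q \<in> K" "\<And>\<theta>. \<theta> \<in> K \<Longrightarrow> g \<theta> $ i \<le> g q $ i"
      using continuous_attains_sup[OF K False g_cont] by blast
    have "((\<lambda>\<epsilon>. f p $ i + \<epsilon> * g q $ i) \<longlongrightarrow> f p $ i + 0 * g q $ i) (at_right 0)"
      by (intro tendsto_intros)
    then have "\<forall>\<^sub>F \<epsilon> in at_right 0. f p $ i + \<epsilon> * g q $ i < 0"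
      by (rule order_tendstoD) (use neg[OF p(1)] in \<open>simp add: vec_less_def\<close>)
    then show ?thesis
      using eventually_at_right_less[of 0]
    proof eventually_elim
      case (elim \<epsilon>)
      have "f \<theta> $ i + \<epsilon> * g \<theta> $ i \<le> f p $ i + \<epsilon> * g q $ i" if "\<theta> \<in> K" for \<theta>
        using p(2)[OF that] q(2)[OF that] elim(2) by (intro add_mono mult_left_mono) auto
      then show ?case
        using elim(1) by (auto intro: le_less_trans)
    qed
  qed
  then have "\<forall>\<^sub>F \<epsilon> in at_right 0. \<forall>i. \<forall>\<theta>\<in>K. f \<theta> $ i + \<epsilon> * g \<theta> $ i < 0"
    by (rule eventually_all_finite)
  then show ?thesis
    by eventually_elim (auto simp: vec_less_def)
qed simp

lemma at_within_atLeast_neq_bot: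
  fixes a s :: real
  assumes "a \<le> s"
  shows "at s within {a..} \<noteq> bot"
proof -
  have "at_right s \<le> at s within {a..}"
    using assms by (intro at_le) auto
  then show ?thesis
    using trivial_limit_at_right_real[of s] by (auto simp: bot_unique)
qed

section \<open>Impulse sequences and impulsive solutions\<close>

lemma range_dwell_time_ge:
  assumes "range_dwell_time Tmin Tmax t"
  shows "k * Tmin \<le> t k"
proof (induction k)
  case (Suc k)
  have "Tmin \<le> t (Suc k) - t k"
    using assms by (simp add: range_dwell_time_def)
  then show ?case
    using Suc by (simp add: algebra_simps)
qed (use assms in \<open>simp add: range_dwell_time_def\<close>)

lemma range_dwell_time_step:
  assumes "range_dwell_time Tmin Tmax t" and "0 < Tmin"
  shows "t (Suc k) - t k \<in> {Tmin..Tmax}" and "t k < t (Suc k)" and "0 \<le> t k"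
proof -
  show step: "t (Suc k) - t k \<in> {Tmin..Tmax}"
    using assms by (simp add: range_dwell_time_def)
  then show "t k < t (Suc k)"
    using assms by simp
  have "0 \<le> k * Tmin"
    using assms by simp
  then show "0 \<le> t k"
    using range_dwell_time_ge[OF assms(1), of k] by linarith
qed

text \<open>
  Since \<open>Tmin > 0\<close> the impulse times tend to infinity, so every positive time belongs to a unique
  flow interval; take the least \<open>n\<close> with \<open>s \<le> t n\<close>.
\<close>

lemma range_dwell_time_cover:
  assumes dwell: "range_dwell_time Tmin Tmax t" and "0 < Tmin" and "0 < s"
  obtains k where "t k < s" and "s \<le> t (Suc k)"
proof -
  obtain n :: nat where "s \<le> n * Tmin"
    using \<open>0 < Tmin\<close> by (metis ex_less_of_nat_mult less_imp_le)
  then have ex: "\<exists>n. s \<le> t n"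
    using range_dwell_time_ge[OF dwell] by (meson order_trans)
  define n where "n = (LEAST n. s \<le> t n)"
  have "s \<le> t n"
    unfolding n_def using ex by (rule LeastI_ex)
  moreover have "n \<noteq> 0"
    using \<open>s \<le> t n\<close> \<open>0 < s\<close> dwell by (auto simp: range_dwell_time_def intro: gr0I)
  then obtain k where "n = Suc k"
    by (cases n) auto
  moreover have "\<not> s \<le> t k"
    using \<open>n = Suc k\<close> not_less_Least[of k "\<lambda>n. s \<le> t n"] by (simp add: n_def[symmetric])
  ultimately show thesis
    using that[of k] by auto
qed

text \<open>
  Together with this symmetry, one-sided bounds yield bounds on absolute values.
\<close>

lemma impulsive_solution_uminus:
  assumes "impulsive_solution A Ec J Ed t x0 wc wd x"
  shows "impulsive_solution A Ec J Ed t (- x0) (\<lambda>s. - wc s) (\<lambda>k. - wd k) (\<lambda>s. - x s)"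
proof -
  have "((\<lambda>s. A s *v - x (t k + s) + Ec s *v - wc (t k + s)) has_integral
      (- x (t k + \<tau>) - - x (t k + \<sigma>))) {\<sigma>..\<tau>}"
    if "0 < \<sigma>" "\<sigma> \<le> \<tau>" "\<tau> \<le> t (Suc k) - t k" for k \<sigma> \<tau>
  proof -
    have "((\<lambda>s. A s *v x (t k + s) + Ec s *v wc (t k + s)) has_integral
        (x (t k + \<tau>) - x (t k + \<sigma>))) {\<sigma>..\<tau>}"
      using assms that by (simp add: impulsive_solution_def)
    from has_integral_neg[OF this] show ?thesis
      by (simp add: matrix_vector_mult_minus_right algebra_simps)
  qed
  moreover have "((\<lambda>s. - x s) \<longlongrightarrow> J *v - x (t k) + Ed *v - wd k) (at_right (t k))" if "1 \<le> k" for k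
  proof -
    have "(x \<longlongrightarrow> J *v x (t k) + Ed *v wd k) (at_right (t k))"
      using assms that by (simp add: impulsive_solution_def)
    from tendsto_minus[OF this] show ?thesis
      by (simp add: matrix_vector_mult_minus_right)
  qed
  moreover have "((\<lambda>s. - x s) \<longlongrightarrow> - x0) (at_right 0)" "- x 0 = - x0"
    using assms by (auto simp: impulsive_solution_def intro: tendsto_minus)
  ultimately show ?thesis
    unfolding impulsive_solution_def by blast
qed

lemma impulsive_output_flow:
  assumes "impulsive_output Cc Fc Cd Fd t wc wd x zc zd" and "t k < s" and "s \<le> t (Suc k)"
  shows "zc s = Cc (s - t k) *v x s + Fc (s - t k) *v wc s"
proof -
  have "0 < s - t k" "s - t k \<le> t (Suc k) - t k"
    using assms by auto
  then have "zc (t k + (s - t k)) = Cc (s - t k) *v x (t k + (s - t k)) + Fc (s - t k) *v wc (t k + (s - t k))"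
    using assms(1) unfolding impulsive_output_def by blast
  then show ?thesis
    by simp
qed

section \<open>Trajectory bounds from a supersolution\<close>

text \<open>
  No flow interval is longer than \<open>Tmax\<close>, so one supersolution on \<open>{0..Tmax}\<close>, taken under the
  constant input \<open>\<one>\<close>, serves all of them. The jump conditions for stability and for the gain differ
  and are therefore left to the individual results.
\<close>

locale impulsive_supersolution =
  fixes Tmin Tmax :: real
    and A :: "real \<Rightarrow> real^'n^'n" and Ec :: "real \<Rightarrow> real^'pc^'n"
    and J :: "real^'n^'n" and Ed :: "real^'pd^'n"
    and \<zeta> \<zeta>' :: "real \<Rightarrow> real^'n"
  assumes Tmin_pos: "0 < Tmin"
    and continuous_A: "continuous_on {0..Tmax} A"
    and metzler_A: "\<And>s. s \<in> {0..Tmax} \<Longrightarrow> metzler (A s)"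
    and Ec_nonneg: "\<And>s. s \<in> {0..Tmax} \<Longrightarrow> 0 \<le> Ec s"
    and J_nonneg: "0 \<le> J" and Ed_nonneg: "0 \<le> Ed"
    and derivative: "\<And>s. s \<in> {0..Tmax} \<Longrightarrow> (\<zeta> has_vector_derivative \<zeta>' s) (at s within {0..Tmax})"
    and super: "\<And>s. s \<in> {0..Tmax} \<Longrightarrow> A s *v \<zeta> s + Ec s *v 1 \<le> \<zeta>' s"

begin

lemma continuous_on_supersolution: "continuous_on {0..Tmax} \<zeta>"
  using derivative by (meson continuous_on_eq_continuous_within has_vector_derivative_continuous)

text \<open>
  The bound \<open>x \<le> c k \<zeta>\<close> on the \<open>k\<close>-th flow interval follows from comparison with \<open>c k \<zeta>\<close>, started
  at the right limit of \<open>x\<close> at \<open>t k\<close>, and the jump hypothesis carries it to the next interval. The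
  weights \<open>c k\<close> cover both uses: geometric decay for the unforced system, and constant weight \<open>1\<close> for the gain.
\<close>

lemma upper_bound:
  assumes dwell: "range_dwell_time Tmin Tmax t"
    and sol: "impulsive_solution A Ec J Ed t x0 wc wd x"
    and N: "negligible N" and wc: "\<And>k s. 0 \<le> s \<Longrightarrow> s \<notin> N \<Longrightarrow> wc s \<le> c k *\<^sub>R 1"
    and c: "\<And>k. 0 \<le> c k" and x0: "x0 \<le> c 0 *\<^sub>R \<zeta> 0"
    and jump: "\<And>k \<theta>. \<theta> \<in> {Tmin..Tmax} \<Longrightarrow>
      c k *\<^sub>R (J *v \<zeta> \<theta>) + Ed *v wd (Suc k) \<le> c (Suc k) *\<^sub>R \<zeta> 0"
    and \<tau>: "0 < \<tau>" "\<tau> \<le> t (Suc k) - t k"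
  shows "x (t k + \<tau>) \<le> c k *\<^sub>R \<zeta> \<tau>"
proof -
  note dwell' = range_dwell_time_step[OF dwell Tmin_pos]
  have flow_bound: "x (t k + \<tau>) \<le> c k *\<^sub>R \<zeta> \<tau>"
    if lim: "(x \<longlongrightarrow> a) (at_right (t k))" and a: "a \<le> c k *\<^sub>R \<zeta> 0"
      and \<tau>: "0 < \<tau>" "\<tau> \<le> t (Suc k) - t k" for k \<tau> a
  proof (rule metzler_comparison[where T = "t (Suc k) - t k" and A = A
        and g = "\<lambda>s. Ec s *v wc (t k + s)" and N = "(+) (- t k) ` N" and \<zeta>' = "\<lambda>s. c k *\<^sub>R \<zeta>' s"])
    have sub: "{0..t (Suc k) - t k} \<subseteq> {0..Tmax}"
      using dwell'[of k] by auto
    show "continuous_on {0..t (Suc k) - t k} A"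
      using continuous_A sub by (rule continuous_on_subset)
    show "metzler (A s)" if "s \<in> {0..t (Suc k) - t k}" for s
      using metzler_A sub that by blast
    show "((\<lambda>\<tau>. x (t k + \<tau>)) \<longlongrightarrow> a) (at_right 0)"
      using lim by (simp add: filterlim_at_right_to_0[of _ _ "t k"] add.commute)
    show "negligible ((+) (- t k) ` N)"
      by (rule negligible_translation[OF N])
    show "((\<lambda>\<tau>. c k *\<^sub>R \<zeta> \<tau>) has_vector_derivative c k *\<^sub>R \<zeta>' s) (at s within {0..t (Suc k) - t k})"
      if "s \<in> {0..t (Suc k) - t k}" for s
      using has_vector_derivative_within_subset[OF derivative sub] that sub
      by (auto intro!: has_vector_derivative_scaleR[OF DERIV_const, simplified])
    show "((\<lambda>s. A s *v x (t k + s) + Ec s *v wc (t k + s)) has_integral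
        x (t k + \<tau>) - x (t k + \<sigma>)) {\<sigma>..\<tau>}"
      if "0 < \<sigma>" "\<sigma> \<le> \<tau>" "\<tau> \<le> t (Suc k) - t k" for \<sigma> \<tau>
      using sol that by (simp add: impulsive_solution_def)
    show "A s *v c k *\<^sub>R \<zeta> s + Ec s *v wc (t k + s) \<le> c k *\<^sub>R \<zeta>' s"
      if s: "s \<in> {0<..t (Suc k) - t k} - (+) (- t k) ` N" for s
    proof -
      have s': "s \<in> {0..Tmax}"
        using s sub by auto
      have "t k + s \<notin> N"
        using s by (metis Diff_iff add.assoc add.left_inverse add_0 image_eqI)
      then have "Ec s *v wc (t k + s) \<le> Ec s *v (c k *\<^sub>R 1)"
        using s' dwell'[of k] by (intro matrix_vector_mult_mono Ec_nonneg wc) auto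
      then have "A s *v c k *\<^sub>R \<zeta> s + Ec s *v wc (t k + s) \<le> c k *\<^sub>R (A s *v \<zeta> s + Ec s *v 1)"
        by (simp add: matrix_vector_mult_scaleR scaleR_add_right)
      also have "\<dots> \<le> c k *\<^sub>R \<zeta>' s"
        using super[OF s'] c[of k] by (auto simp: less_eq_vec_def intro: mult_left_mono)
      finally show ?thesis .
    qed
  qed (use a \<tau> in auto)
  have "\<exists>a. (x \<longlongrightarrow> a) (at_right (t k)) \<and> a \<le> c k *\<^sub>R \<zeta> 0" for k
  proof (induction k)
    case 0
    then show ?case
      using sol dwell x0 by (auto simp: impulsive_solution_def range_dwell_time_def)
  next
    case (Suc k)
    let ?T = "t (Suc k) - t k"
    have "0 < ?T"
      using dwell'(2)[of k] by simp
    \<comment> \<open>At the end of the flow interval the bound passes through the nonnegative matrix \<open>J\<close>.\<close>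
    then have "x (t k + ?T) \<le> c k *\<^sub>R \<zeta> ?T"
      using Suc by (blast intro: flow_bound)
    then have "J *v x (t (Suc k)) + Ed *v wd (Suc k) \<le> c k *\<^sub>R (J *v \<zeta> ?T) + Ed *v wd (Suc k)"
      using matrix_vector_mult_mono[OF J_nonneg, of "x (t (Suc k))" "c k *\<^sub>R \<zeta> ?T"]
      by (simp add: matrix_vector_mult_scaleR)
    also have "\<dots> \<le> c (Suc k) *\<^sub>R \<zeta> 0"
      by (rule jump[OF dwell'(1)])
    finally show ?case
      using sol by (auto simp: impulsive_solution_def)
  qed
  then show ?thesis
    using flow_bound \<tau> by blast
qed

lemma abs_bound:
  assumes dwell: "range_dwell_time Tmin Tmax t"
    and sol: "impulsive_solution A Ec J Ed t x0 wc wd x"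
    and N: "negligible N" and wc: "\<And>k s i. 0 \<le> s \<Longrightarrow> s \<notin> N \<Longrightarrow> \<bar>wc s $ i\<bar> \<le> c k"
    and c: "\<And>k. 0 \<le> c k" and x0: "\<And>i. \<bar>x0 $ i\<bar> \<le> c 0 * \<zeta> 0 $ i"
    and wd: "\<And>k i. \<bar>wd (Suc k) $ i\<bar> \<le> d"
    and jump: "\<And>k \<theta>. \<theta> \<in> {Tmin..Tmax} \<Longrightarrow>
      c k *\<^sub>R (J *v \<zeta> \<theta>) + d *\<^sub>R (Ed *v 1) \<le> c (Suc k) *\<^sub>R \<zeta> 0"
    and \<tau>: "0 < \<tau>" "\<tau> \<le> t (Suc k) - t k"
  shows "\<bar>x (t k + \<tau>) $ i\<bar> \<le> c k * \<zeta> \<tau> $ i"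
proof -
  have Ed: "Ed *v v \<le> d *\<^sub>R (Ed *v 1)" if "\<And>i. v $ i \<le> d" for v
    using matrix_vector_mult_mono[OF Ed_nonneg, of v "d *\<^sub>R 1"] that
    by (simp add: less_eq_vec_def matrix_vector_mult_scaleR)
  have jump': "c k *\<^sub>R (J *v \<zeta> \<theta>) + Ed *v v \<le> c (Suc k) *\<^sub>R \<zeta> 0"
    if "\<theta> \<in> {Tmin..Tmax}" "\<And>i. v $ i \<le> d" for k \<theta> v
    using order_trans[OF add_left_mono[OF Ed] jump] that by blast
  have "x (t k + \<tau>) \<le> c k *\<^sub>R \<zeta> \<tau>"
    by (rule upper_bound[OF dwell sol N]) (use wc c x0 wd jump' \<tau> in \<open>auto simp: less_eq_vec_def abs_le_iff\<close>)
  moreover have "- x (t k + \<tau>) \<le> c k *\<^sub>R \<zeta> \<tau>"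
    by (rule upper_bound[OF dwell impulsive_solution_uminus[OF sol] N])
      (use wc c x0 wd jump' \<tau> in \<open>auto simp: less_eq_vec_def abs_le_iff\<close>)
  ultimately show ?thesis
    by (auto simp: less_eq_vec_def abs_le_iff)
qed

text \<open>
  Each impulse multiplies the bound by \<open>\<alpha> < 1\<close>, and impulses never stop occurring.
\<close>

lemma asymptotic_stability:
  assumes \<zeta>0: "0 <\<^sub>v \<zeta> 0" and \<alpha>: "0 \<le> \<alpha>" "\<alpha> < 1"
    and contract: "\<And>\<theta>. \<theta> \<in> {Tmin..Tmax} \<Longrightarrow> J *v \<zeta> \<theta> \<le> \<alpha> *\<^sub>R \<zeta> 0"
  shows "asymptotically_stable Tmin Tmax A Ec J Ed"
proof -
  \<comment> \<open>The bounds \<open>m\<close> and \<open>M\<close> convert between the norm and multiples of \<open>\<zeta>\<close>.\<close>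
  define m where "m = Min (range (\<lambda>i. \<zeta> 0 $ i))"
  have "m \<in> range (\<lambda>i. \<zeta> 0 $ i)"
    unfolding m_def by (intro Min_in) auto
  then have "0 < m"
    using \<zeta>0 by (auto simp: vec_less_def)
  have m: "m \<le> \<zeta> 0 $ i" for i
    unfolding m_def by (intro Min_le) auto
  have "compact ((\<lambda>s. \<Sum>i\<in>UNIV. \<zeta> s $ i) ` {0..Tmax})"
    by (intro compact_continuous_image continuous_intros continuous_on_supersolution) auto
  then have "bounded ((\<lambda>s. \<Sum>i\<in>UNIV. \<zeta> s $ i) ` {0..Tmax})"
    by (rule compact_imp_bounded)
  then obtain M where "0 < M" and M: "\<And>s. s \<in> {0..Tmax} \<Longrightarrow> \<bar>\<Sum>i\<in>UNIV. \<zeta> s $ i\<bar> \<le> M"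
    unfolding bounded_pos real_norm_def by blast
  have bound: "norm (x (t k + \<tau>)) \<le> norm x0 / m * \<alpha> ^ k * M"
    if dwell: "range_dwell_time Tmin Tmax t"
      and sol: "impulsive_solution A Ec J Ed t x0 (\<lambda>_. 0) (\<lambda>_. 0) x"
      and \<tau>: "0 < \<tau>" "\<tau> \<le> t (Suc k) - t k" for t x0 x k \<tau>
  proof -
    let ?c = "\<lambda>k. norm x0 / m * \<alpha> ^ k"
    have c: "0 \<le> ?c k" for k
      using \<alpha> \<open>0 < m\<close> by auto
    have "\<bar>x (t k + \<tau>) $ i\<bar> \<le> ?c k * \<zeta> \<tau> $ i" for i
    proof (rule abs_bound[OF dwell sol, where N = "{}" and d = 0 and c = ?c])
      show "\<bar>x0 $ i\<bar> \<le> ?c 0 * \<zeta> 0 $ i" for i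
      proof -
        have "\<bar>x0 $ i\<bar> \<le> norm x0 / m * m"
          using component_le_norm_cart[of x0 i] \<open>0 < m\<close> by simp
        also have "\<dots> \<le> norm x0 / m * \<zeta> 0 $ i"
          using m \<open>0 < m\<close> by (intro mult_left_mono) auto
        finally show ?thesis
          by simp
      qed
      show "?c k *\<^sub>R (J *v \<zeta> \<theta>) + 0 *\<^sub>R (Ed *v 1) \<le> ?c (Suc k) *\<^sub>R \<zeta> 0"
        if "\<theta> \<in> {Tmin..Tmax}" for k \<theta>
        unfolding less_eq_vec_def
      proof
        fix i
        have "(J *v \<zeta> \<theta>) $ i \<le> \<alpha> * \<zeta> 0 $ i"
          using contract[OF that] by (simp add: less_eq_vec_def)
        from mult_left_mono[OF this c[of k]]
        show "(?c k *\<^sub>R (J *v \<zeta> \<theta>) + 0 *\<^sub>R (Ed *v 1)) $ i \<le> (?c (Suc k) *\<^sub>R \<zeta> 0) $ i"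
          by (simp add: mult_ac)
      qed
    qed (use c \<tau> in auto)
    then have "(\<Sum>i\<in>UNIV. \<bar>x (t k + \<tau>) $ i\<bar>) \<le> (\<Sum>i\<in>UNIV. ?c k * \<zeta> \<tau> $ i)"
      by (intro sum_mono)
    also have "\<dots> = ?c k * (\<Sum>i\<in>UNIV. \<zeta> \<tau> $ i)"
      by (simp only: sum_distrib_left)
    also have "\<dots> \<le> ?c k * M"
    proof (rule mult_left_mono[OF _ c])
      have "t (Suc k) - t k \<le> Tmax"
        using dwell by (simp add: range_dwell_time_def)
      then show "(\<Sum>i\<in>UNIV. \<zeta> \<tau> $ i) \<le> M"
        using M[of \<tau>] \<tau> by (auto simp: abs_le_iff)
    qed
    finally show ?thesis
      using norm_le_l1_cart[of "x (t k + \<tau>)"] by linarith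
  qed
  have stable: "\<exists>\<delta>>0. \<forall>x0 x. norm x0 < \<delta> \<and> impulsive_solution A Ec J Ed t x0 (\<lambda>_. 0) (\<lambda>_. 0) x \<longrightarrow>
      (\<forall>s\<ge>0. norm (x s) < \<epsilon>)"
    if dwell: "range_dwell_time Tmin Tmax t" and "0 < \<epsilon>" for t and \<epsilon> :: real
  proof (intro exI conjI allI impI)
    \<comment> \<open>The entry \<open>\<epsilon>\<close> of the minimum is for time \<open>0\<close>, which lies in no flow interval.\<close>
    show "0 < min \<epsilon> (\<epsilon> * m / M)"
      using \<open>0 < \<epsilon>\<close> \<open>0 < m\<close> \<open>0 < M\<close> by simp
    fix x0 x s
    assume *: "norm x0 < min \<epsilon> (\<epsilon> * m / M) \<and> impulsive_solution A Ec J Ed t x0 (\<lambda>_. 0) (\<lambda>_. 0) x"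
      and "0 \<le> (s::real)"
    show "norm (x s) < \<epsilon>"
    proof (cases "s = 0")
      case True
      then show ?thesis
        using * by (auto simp: impulsive_solution_def)
    next
      case False
      then have "0 < s"
        using \<open>0 \<le> s\<close> by simp
      then obtain k where k: "t k < s" "s \<le> t (Suc k)"
        by (rule range_dwell_time_cover[OF dwell Tmin_pos])
      then have "norm (x s) \<le> norm x0 / m * \<alpha> ^ k * M"
        using bound[OF dwell, of x0 x "s - t k" k] * by auto
      also have "\<dots> \<le> norm x0 / m * 1 * M"
        using \<alpha> \<open>0 < m\<close> \<open>0 < M\<close>
        by (intro mult_right_mono mult_left_mono power_le_one) auto
      also have "\<dots> < \<epsilon>"
        using * \<open>0 < m\<close> \<open>0 < M\<close> by (simp add: field_simps)
      finally show ?thesis .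
    qed
  qed
  have attractive: "(x \<longlongrightarrow> 0) at_top"
    if dwell: "range_dwell_time Tmin Tmax t"
      and sol: "impulsive_solution A Ec J Ed t x0 (\<lambda>_. 0) (\<lambda>_. 0) x" for t x0 x
  proof (rule tendstoI)
    fix \<epsilon> :: real assume "0 < \<epsilon>"
    have "(\<lambda>k. norm x0 / m * \<alpha> ^ k * M) \<longlonglongrightarrow> norm x0 / m * 0 * M"
      using \<alpha> by (intro tendsto_intros LIMSEQ_realpow_zero)
    then have "\<forall>\<^sub>F k in sequentially. norm x0 / m * \<alpha> ^ k * M < \<epsilon>"
      by (rule order_tendstoD) (use \<open>0 < \<epsilon>\<close> in simp)
    then obtain K where K: "\<And>k. K \<le> k \<Longrightarrow> norm x0 / m * \<alpha> ^ k * M < \<epsilon>"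
      unfolding eventually_sequentially by blast
    have "norm (x s) < \<epsilon>" if "max 0 (t K) < s" for s
    proof -
      have "0 < s"
        using that by simp
      then obtain k where k: "t k < s" "s \<le> t (Suc k)"
        by (rule range_dwell_time_cover[OF dwell Tmin_pos])
      have "t n \<le> t (Suc n)" for n
        using range_dwell_time_step(2)[OF dwell Tmin_pos] by (rule less_imp_le)
      then have "t (Suc k) \<le> t K" if "Suc k \<le> K"
        using that by (rule lift_Suc_mono_le)
      then have "K \<le> k"
        using that k by (auto simp flip: not_less_eq_eq)
      moreover have "norm (x s) \<le> norm x0 / m * \<alpha> ^ k * M"
        using bound[OF dwell sol, of "s - t k" k] k by auto
      ultimately show ?thesis
        using K by fastforce
    qed
    then show "\<forall>\<^sub>F s in at_top. dist (x s) 0 < \<epsilon>"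
      using eventually_gt_at_top[of "max 0 (t K)"] by (auto elim!: eventually_mono)
  qed
  show ?thesis
    unfolding asymptotically_stable_def using stable attractive by blast
qed

text \<open>
  The essential supremum of a nonmeasurable function is \<open>\<infinity>\<close>, so the gain bound needs measurability of
  the output. On each of the countably many flow intervals the output is built from the continuous
  state, continuous matrices and the measurable input.
\<close>

lemma output_measurable:
  fixes Cc :: "real \<Rightarrow> real^'n^'qc" and Fc :: "real \<Rightarrow> real^'pc^'qc"
  assumes dwell: "range_dwell_time Tmin Tmax t"
    and sol: "impulsive_solution A Ec J Ed t x0 wc wd x"
    and out: "impulsive_output Cc Fc Cd Fd t wc wd x zc zd"
    and wc: "wc \<in> borel_measurable (lebesgue_on {0..})"
    and Cc: "continuous_on {0..Tmax} Cc" and Fc: "continuous_on {0..Tmax} Fc"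
  shows "zc \<in> borel_measurable (lebesgue_on {0..})"
proof (rule measurable_piecewise_restrict[of "insert {0} (range (\<lambda>k. {t k<..t (Suc k)}))"])
  show "space (lebesgue_on {0..}) \<subseteq> \<Union> (insert {0} (range (\<lambda>k. {t k<..t (Suc k)})))"
  proof
    fix s :: real assume "s \<in> space (lebesgue_on {0..})"
    then show "s \<in> \<Union> (insert {0} (range (\<lambda>k. {t k<..t (Suc k)})))"
      using range_dwell_time_cover[OF dwell Tmin_pos, of s] by (cases "s = 0") fastforce+
  qed
  fix \<Omega> assume \<Omega>: "\<Omega> \<in> insert {0} (range (\<lambda>k. {t k<..t (Suc k)}))"
  then have "\<Omega> \<in> sets lebesgue"
    by auto
  then have "{0..} \<inter> \<Omega> \<in> sets (lebesgue_on {0..})"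
    unfolding sets_restrict_space by (rule imageI)
  then show "\<Omega> \<inter> space (lebesgue_on {0..}) \<in> sets (lebesgue_on {0..})"
    by (simp add: space_restrict_space Int_commute)
  from \<Omega> consider "\<Omega> = {0}" | k where "\<Omega> = {t k<..t (Suc k)}"
    by auto
  then show "zc \<in> borel_measurable (restrict_space (lebesgue_on {0..}) \<Omega>)"
  proof cases
    case 1
    show ?thesis
      by (rule measurable_cong[THEN iffD2, OF _ measurable_const[of "zc 0"]])
        (auto simp: 1 space_restrict_space)
  next
    case 2
    have t: "0 \<le> t k" "t (Suc k) - t k \<le> Tmax"
      using range_dwell_time_step[OF dwell Tmin_pos, of k] by auto
    have "\<Omega> \<subseteq> {0..}"
      using t 2 by auto
    then have restrict: "restrict_space (lebesgue_on {0..}) \<Omega> = lebesgue_on \<Omega>"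
      by (subst restrict_restrict_space) (auto simp: 2 Int_absorb1)
    have shift: "continuous_on \<Omega> (\<lambda>s. f (s - t k))"
      if "continuous_on {0<..t (Suc k) - t k} f" for f :: "real \<Rightarrow> 'z::topological_space"
      by (rule continuous_on_compose2[OF that]) (auto simp: 2 intro!: continuous_intros)
    have "continuous_on {0<..t (Suc k) - t k} (\<lambda>\<tau>. x (t k + \<tau>))"
      by (rule continuous_on_flow) (use sol in \<open>auto simp: impulsive_solution_def\<close>)
    from shift[OF this] have x: "continuous_on \<Omega> x"
      by simp
    have "{0<..t (Suc k) - t k} \<subseteq> {0..Tmax}"
      using t by auto
    note CF = continuous_on_subset[OF Cc this, THEN shift] continuous_on_subset[OF Fc this, THEN shift]
    have meas: "f \<in> borel_measurable (lebesgue_on \<Omega>)"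
      if "continuous_on \<Omega> f" for f :: "real \<Rightarrow> 'e::euclidean_space"
      by (rule continuous_imp_measurable_on_sets_lebesgue[OF that]) (simp add: 2)
    have "(\<lambda>s. Cc (s - t k) *v x s + Fc (s - t k) *v wc s) \<in> borel_measurable (lebesgue_on \<Omega>)"
      using measurable_restrict_space1[OF wc, of \<Omega>] unfolding restrict
      by (intro borel_measurable_add measurable_matrix_vector_mult meas[OF CF(1)] meas[OF CF(2)]
          meas[OF x])
    moreover have "zc s = Cc (s - t k) *v x s + Fc (s - t k) *v wc s" if "s \<in> \<Omega>" for s
      using impulsive_output_flow[OF out] that 2 by simp
    ultimately show ?thesis
      unfolding restrict by (subst measurable_cong) (auto simp: space_restrict_space)
  qed
qed simp

text \<open>
  With inputs bounded by \<open>1\<close> and zero initial state, the bound \<open>\<bar>x\<bar> \<le> \<zeta>\<close> reproduces itself across each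
  impulse, and the output conditions are evaluated at this worst case.
\<close>

lemma hybrid_gain_le:
  fixes Cc :: "real \<Rightarrow> real^'n^'qc" and Fc :: "real \<Rightarrow> real^'pc^'qc"
    and Cd :: "real^'n^'qd" and Fd :: "real^'pd^'qd"
  assumes \<zeta>0: "0 \<le> \<zeta> 0"
    and jump: "\<And>\<theta>. \<theta> \<in> {Tmin..Tmax} \<Longrightarrow> J *v \<zeta> \<theta> + Ed *v 1 \<le> \<zeta> 0"
    and Cc: "continuous_on {0..Tmax} Cc" and Fc: "continuous_on {0..Tmax} Fc"
    and nonneg: "\<And>s. s \<in> {0..Tmax} \<Longrightarrow> 0 \<le> Cc s \<and> 0 \<le> Fc s" "0 \<le> Cd" "0 \<le> Fd"
    and outc: "\<And>s. s \<in> {0..Tmax} \<Longrightarrow> Cc s *v \<zeta> s + Fc s *v 1 \<le> \<gamma> *\<^sub>R 1"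
    and outd: "\<And>\<theta>. \<theta> \<in> {Tmin..Tmax} \<Longrightarrow> Cd *v \<zeta> \<theta> + Fd *v 1 \<le> \<gamma> *\<^sub>R 1"
  shows "hybrid_gain Tmin Tmax A Ec Cc Fc J Ed Cd Fd \<le> ereal \<gamma>"
  unfolding hybrid_gain_def
proof (rule Sup_least, clarsimp simp only: mem_Collect_eq)
  fix zc :: "real \<Rightarrow> real^'qc" and zd :: "nat \<Rightarrow> real^'qd" and t wc wd x
  assume dwell: "range_dwell_time Tmin Tmax t"
    and wc: "wc \<in> borel_measurable (lebesgue_on {0..})"
    and w: "max (Linf_norm wc) (linf_norm wd) = 1"
    and sol: "impulsive_solution A Ec J Ed t 0 wc wd x"
    and out: "impulsive_output Cc Fc Cd Fd t wc wd x zc zd"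
  note T = range_dwell_time_step[OF dwell Tmin_pos]
  have "Linf_norm wc \<le> 1" "linf_norm wd \<le> 1"
    unfolding w[symmetric] by auto
  have wd: "\<bar>wd (Suc k) $ i\<bar> \<le> 1" for k i
  proof -
    have "ereal (infnorm (wd (Suc k))) \<le> linf_norm wd"
      unfolding linf_norm_def by (rule SUP_upper) simp
    also note \<open>linf_norm wd \<le> 1\<close>
    finally have "infnorm (wd (Suc k)) \<le> 1"
      by (simp add: one_ereal_def)
    then show ?thesis
      using component_le_infnorm_cart[of "wd (Suc k)" i] by simp
  qed
  have "AE s in lebesgue_on {0..}. ereal (infnorm (wc s)) \<le> Linf_norm wc"
    unfolding Linf_norm_def by (rule esssup_AE)
  then have "AE s in lebesgue. s \<in> {0..} \<longrightarrow> ereal (infnorm (wc s)) \<le> Linf_norm wc"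
    by (subst (asm) AE_restrict_space_iff) auto
  then obtain N where N: "{s. \<not> (s \<in> {0..} \<longrightarrow> ereal (infnorm (wc s)) \<le> Linf_norm wc)} \<subseteq> N"
      "N \<in> null_sets lebesgue"
    unfolding eventually_ae_filter by auto
  then have "negligible N"
    by (simp add: negligible_iff_null_sets)
  have wN: "\<bar>wc s $ i\<bar> \<le> 1" if "0 \<le> s" "s \<notin> N" for s i
  proof -
    have "ereal (infnorm (wc s)) \<le> Linf_norm wc"
      using N(1) that by auto
    also note \<open>Linf_norm wc \<le> 1\<close>
    finally have "infnorm (wc s) \<le> 1"
      by (simp add: one_ereal_def)
    then show ?thesis
      using component_le_infnorm_cart[of "wc s" i] by simp
  qed
  have x: "\<bar>x (t k + \<tau>) $ i\<bar> \<le> \<zeta> \<tau> $ i" if "0 < \<tau>" "\<tau> \<le> t (Suc k) - t k" for k \<tau> i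
    using abs_bound[OF dwell sol \<open>negligible N\<close>, of "\<lambda>_. 1" 1] wN wd \<zeta>0 jump that
    by (auto simp: less_eq_vec_def)
  have "Linf_norm zc \<le> ereal \<gamma>"
    unfolding Linf_norm_def
  proof (rule esssup_I)
    have "(\<lambda>s. infnorm (zc s)) \<in> borel_measurable (lebesgue_on {0..})"
      using output_measurable[OF dwell sol out wc Cc Fc]
      by (rule borel_measurable_continuous_on[rotated]) (intro continuous_intros)
    then show "(\<lambda>s. ereal (infnorm (zc s))) \<in> borel_measurable (lebesgue_on {0..})"
      by simp
    \<comment> \<open>The output equation does not constrain \<open>zc 0\<close>, so \<open>0\<close> joins the exceptional set.\<close>
    have "infnorm (zc s) \<le> \<gamma>" if s: "s \<in> {0..}" "s \<notin> insert 0 N" for s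
    proof -
      have "0 < s"
        using s by (simp add: less_le)
      then obtain k where k: "t k < s" "s \<le> t (Suc k)"
        by (rule range_dwell_time_cover[OF dwell Tmin_pos])
      have "s - t k \<in> {0..Tmax}"
        using k T[of k] by auto
      moreover have "zc s = Cc (s - t k) *v x s + Fc (s - t k) *v wc s"
        using impulsive_output_flow[OF out k] .
      moreover have "\<bar>x s $ i\<bar> \<le> \<zeta> (s - t k) $ i" for i
        using x[of "s - t k" k i] k by simp
      ultimately show ?thesis
        using infnorm_output_le[OF _ _ _ _ outc, of "s - t k" "x s" "wc s"] nonneg(1)[of "s - t k"] wN[of s] s
        by simp
    qed
    then have "AE s in lebesgue. s \<in> {0..} \<longrightarrow> ereal (infnorm (zc s)) \<le> ereal \<gamma>"
      using \<open>negligible N\<close>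
      by (intro AE_I'[of "insert 0 N"]) (auto simp flip: negligible_iff_null_sets)
    then show "AE s in lebesgue_on {0..}. ereal (infnorm (zc s)) \<le> ereal \<gamma>"
      by (subst AE_restrict_space_iff) auto
  qed
  moreover have "linf_norm zd \<le> ereal \<gamma>"
    unfolding linf_norm_def
  proof (rule SUP_least)
    fix k :: nat assume "k \<in> {1..}"
    then obtain j where k: "k = Suc j"
      by (cases k) auto
    have xk: "\<bar>x (t k) $ i\<bar> \<le> \<zeta> (t (Suc j) - t j) $ i" for i
      using x[of "t (Suc j) - t j" j i] T[of j] k by simp
    have "infnorm (Cd *v x (t k) + Fd *v wd k) \<le> \<gamma>"
      using infnorm_output_le[OF nonneg(2,3) xk wd outd[OF T(1)]] by (simp add: k)
    then show "ereal (infnorm (zd k)) \<le> ereal \<gamma>"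
      using out k by (simp add: impulsive_output_def)
  qed
  ultimately show "max (Linf_norm zc) (linf_norm zd) \<le> ereal \<gamma>"
    by simp
qed

end

section \<open>Equivalence of the conditions, stability and gain\<close>

theorem theorem3p4:
  fixes Tmin Tmax \<gamma> :: real
    and A :: "real \<Rightarrow> real^'n^'n"
    and Ec :: "real \<Rightarrow> real^'pc^'n"
    and Cc :: "real \<Rightarrow> real^'n^'qc"
    and Fc :: "real \<Rightarrow> real^'pc^'qc"
    and J :: "real^'n^'n"
    and Ed :: "real^'pd^'n"
    and Cd :: "real^'n^'qd"
    and Fd :: "real^'pd^'qd"
    and \<Phi> :: "real \<Rightarrow> real \<Rightarrow> real^'n^'n"
    and stmt_a stmt_b stmt_c :: bool
  assumes "0 < Tmin" and "Tmin \<le> Tmax" and "0 < \<gamma>"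
    and "continuous_on {0..} A" and "bounded (A ` {0..})"
    and "continuous_on {0..} Ec" and "bounded (Ec ` {0..})"
    and "continuous_on {0..} Cc" and "bounded (Cc ` {0..})"
    and "continuous_on {0..} Fc" and "bounded (Fc ` {0..})"
    and "\<And>\<tau>. 0 \<le> \<tau> \<Longrightarrow> metzler (A \<tau>)"
    and "\<And>\<tau>. 0 \<le> \<tau> \<Longrightarrow> 0 \<le> Ec \<tau> \<and> 0 \<le> Cc \<tau> \<and> 0 \<le> Fc \<tau>"
    and "0 \<le> J" and "0 \<le> Ed" and "0 \<le> Cd" and "0 \<le> Fd"
    and "state_transition_matrix A \<Phi>"
  defines "stmt_a \<equiv> \<exists>l::real^'n. 0 <\<^sub>v l \<and>
      (\<forall>\<tau>\<in>{0..Tmax}. \<forall>\<theta>\<in>{Tmin..Tmax}.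
        (J ** \<Phi> \<theta> 0 - mat 1) *v l
          + J *v integral {0..\<theta>} (\<lambda>s. \<Phi> \<theta> s *v (Ec s *v 1)) + Ed *v 1 <\<^sub>v 0 \<and>
        Cc \<tau> *v (\<Phi> \<tau> 0 *v l + integral {0..\<tau>} (\<lambda>s. \<Phi> \<tau> s *v (Ec s *v 1)))
          + Fc \<tau> *v 1 <\<^sub>v \<gamma> *\<^sub>R 1 \<and>
        Cd *v (\<Phi> \<theta> 0 *v l + integral {0..\<theta>} (\<lambda>s. \<Phi> \<theta> s *v (Ec s *v 1)))
          + Fd *v 1 <\<^sub>v \<gamma> *\<^sub>R 1)"
    and "stmt_b \<equiv> \<exists>\<zeta>::real \<Rightarrow> real^'n. \<zeta> differentiable_on {0..} \<and> 0 <\<^sub>v \<zeta> 0 \<and>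
      (\<forall>\<tau>\<in>{0..Tmax}. \<forall>\<theta>\<in>{Tmin..Tmax}.
        - vector_derivative \<zeta> (at \<tau> within {0..}) + A \<tau> *v \<zeta> \<tau> + Ec \<tau> *v 1 <\<^sub>v 0 \<and>
        Cc \<tau> *v \<zeta> \<tau> + Fc \<tau> *v 1 - \<gamma> *\<^sub>R 1 <\<^sub>v 0 \<and>
        J *v \<zeta> \<theta> - \<zeta> 0 + Ed *v 1 <\<^sub>v 0 \<and>
        Cd *v \<zeta> \<theta> + Fd *v 1 - \<gamma> *\<^sub>R 1 <\<^sub>v 0)"
    and "stmt_c \<equiv> \<exists>(\<zeta>::real \<Rightarrow> real^'n) (\<mu>::real \<Rightarrow> real^'n).
      \<zeta> differentiable_on {0..} \<and> 0 <\<^sub>v \<zeta> 0 \<and>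
      (\<forall>\<tau>\<in>{0..Tmax}. \<forall>\<theta>\<in>{Tmin..Tmax}.
        - vector_derivative \<zeta> (at \<tau> within {0..}) + A \<tau> *v \<zeta> \<tau> + Ec \<tau> *v 1 <\<^sub>v 0 \<and>
        Cc \<tau> *v \<zeta> \<tau> + Fc \<tau> *v 1 - \<gamma> *\<^sub>R 1 <\<^sub>v 0 \<and>
        \<zeta> \<theta> - \<mu> \<theta> \<le> 0 \<and>
        J *v \<mu> \<theta> - \<zeta> 0 + Ed *v 1 <\<^sub>v 0 \<and>
        Cd *v \<mu> \<theta> + Fd *v 1 - \<gamma> *\<^sub>R 1 <\<^sub>v 0)"
  shows "(stmt_a \<longleftrightarrow> stmt_b) \<and> (stmt_b \<longleftrightarrow> stmt_c) \<and>
    (stmt_a \<or> stmt_b \<or> stmt_c \<longrightarrow>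
      asymptotically_stable Tmin Tmax A Ec J Ed \<and>
      hybrid_gain Tmin Tmax A Ec Cc Fc J Ed Cd Fd \<le> ereal \<gamma>)"
proof -
  note Tmin = \<open>0 < Tmin\<close> and Tmax = \<open>Tmin \<le> Tmax\<close>
  note contA = \<open>continuous_on {0..} A\<close> and contEc = \<open>continuous_on {0..} Ec\<close>
    and contCc = \<open>continuous_on {0..} Cc\<close> and contFc = \<open>continuous_on {0..} Fc\<close>
  note metz = \<open>\<And>\<tau>. 0 \<le> \<tau> \<Longrightarrow> metzler (A \<tau>)\<close>
    and nonneg = \<open>\<And>\<tau>. 0 \<le> \<tau> \<Longrightarrow> 0 \<le> Ec \<tau> \<and> 0 \<le> Cc \<tau> \<and> 0 \<le> Fc \<tau>\<close>
    and Jn = \<open>0 \<le> J\<close> and Edn = \<open>0 \<le> Ed\<close> and Cdn = \<open>0 \<le> Cd\<close> and Fdn = \<open>0 \<le> Fd\<close>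
  note st = \<open>state_transition_matrix A \<Phi>\<close>
  have sub: "{0..Tmax} \<subseteq> {0..}" "{Tmin..Tmax} \<subseteq> {0..}" "{Tmin..Tmax} \<subseteq> {0..Tmax}"
    "0 \<in> {0..Tmax}" "Tmin \<in> {Tmin..Tmax}"
    using Tmin Tmax by auto
  define u where "u s = Ec s *v 1" for s
  have contu: "continuous_on {0..} u"
    unfolding u_def by (intro continuous_intros contEc)
  define \<eta> where "\<eta> = forced_response \<Phi> u"
  have \<eta>0: "\<eta> l 0 = l" for l
    unfolding \<eta>_def by (rule forced_response_0[OF st])
  have der\<eta>: "(\<eta> l has_vector_derivative A s *v \<eta> l s + u s) (at s within {0..})" if "0 \<le> s" for l s
    unfolding \<eta>_def by (rule forced_response_derivative[OF st contA metz contu that])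
  have cont\<eta>: "continuous_on {0..} (\<eta> l)" for l
    using der\<eta> by (meson atLeast_iff continuous_on_eq_continuous_within has_vector_derivative_continuous)
  \<comment> \<open>Condition (a) for the vector \<open>l\<close>, written like (b) with the response \<open>\<eta> l\<close> for \<open>\<zeta>\<close>.\<close>
  define \<P> where "\<P> l \<longleftrightarrow> (\<forall>\<tau>\<in>{0..Tmax}. \<forall>\<theta>\<in>{Tmin..Tmax}.
      J *v \<eta> l \<theta> - l + Ed *v 1 <\<^sub>v 0 \<and>
      Cc \<tau> *v \<eta> l \<tau> + Fc \<tau> *v 1 - \<gamma> *\<^sub>R 1 <\<^sub>v 0 \<and>
      Cd *v \<eta> l \<theta> + Fd *v 1 - \<gamma> *\<^sub>R 1 <\<^sub>v 0)" for l
  have a_iff: "stmt_a \<longleftrightarrow> (\<exists>l. 0 <\<^sub>v l \<and> \<P> l)"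
  proof -
    have "(J ** \<Phi> \<theta> 0 - mat 1) *v l + J *v integral {0..\<theta>} (\<lambda>s. \<Phi> \<theta> s *v (Ec s *v 1))
        = J *v \<eta> l \<theta> - l" for l \<theta>
      by (simp add: \<eta>_def forced_response_def u_def matrix_vector_mult_diff_rdistrib
          matrix_vector_right_distrib matrix_vector_mul_assoc)
    moreover have "\<Phi> \<tau> 0 *v l + integral {0..\<tau>} (\<lambda>s. \<Phi> \<tau> s *v (Ec s *v 1)) = \<eta> l \<tau>" for l \<tau>
      by (simp add: \<eta>_def forced_response_def u_def)
    ultimately show ?thesis
      unfolding stmt_a_def \<P>_def by (simp add: vec_less_def)
  qed
  have "stmt_b" if a: "stmt_a"
  proof -
    obtain l where l: "0 <\<^sub>v l" "\<P> l"
      using a a_iff by blast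
    obtain L where L: "\<And>s i. s \<in> {0..Tmax} \<Longrightarrow> 1 \<le> (exp (L * s) *\<^sub>R (L *\<^sub>R 1 - A s *v 1)) $ i"
      using exp_supersolution[OF continuous_on_subset[OF contA sub(1)]] by metis
    \<comment> \<open>The response \<open>\<eta> l\<close> satisfies the flow condition with equality; \<open>\<xi>\<close> will make it strict.\<close>
    define \<xi> :: "real \<Rightarrow> real^'n" where "\<xi> s = exp (L * s) *\<^sub>R 1" for s
    have cont\<xi>: "continuous_on S \<xi>" for S
      unfolding \<xi>_def by (intro continuous_intros)
    note conts = continuous_on_subset[OF contCc sub(1)] continuous_on_subset[OF contFc sub(1)]
      continuous_on_subset[OF cont\<eta> sub(1)] continuous_on_subset[OF cont\<eta> sub(2)] cont\<xi>
    have neg: "\<And>\<theta>. \<theta> \<in> {Tmin..Tmax} \<Longrightarrow> J *v \<eta> l \<theta> - l + Ed *v 1 <\<^sub>v 0"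
      "\<And>\<tau>. \<tau> \<in> {0..Tmax} \<Longrightarrow> Cc \<tau> *v \<eta> l \<tau> + Fc \<tau> *v 1 - \<gamma> *\<^sub>R 1 <\<^sub>v 0"
      "\<And>\<theta>. \<theta> \<in> {Tmin..Tmax} \<Longrightarrow> Cd *v \<eta> l \<theta> + Fd *v 1 - \<gamma> *\<^sub>R 1 <\<^sub>v 0"
      using l(2) sub(4,5) unfolding \<P>_def by blast+
    have "\<forall>\<^sub>F \<epsilon> in at_right 0. \<forall>\<theta>\<in>{Tmin..Tmax}.
        (J *v \<eta> l \<theta> - l + Ed *v 1) + \<epsilon> *\<^sub>R (J *v \<xi> \<theta> - \<xi> 0) <\<^sub>v 0"
      by (rule eventually_vec_less_perturbed[OF _ _ compact_Icc neg(1)])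
        (intro continuous_intros conts)+
    moreover have "\<forall>\<^sub>F \<epsilon> in at_right 0. \<forall>\<tau>\<in>{0..Tmax}.
        (Cc \<tau> *v \<eta> l \<tau> + Fc \<tau> *v 1 - \<gamma> *\<^sub>R 1) + \<epsilon> *\<^sub>R (Cc \<tau> *v \<xi> \<tau>) <\<^sub>v 0"
      by (rule eventually_vec_less_perturbed[OF _ _ compact_Icc neg(2)])
        (intro continuous_intros conts)+
    moreover have "\<forall>\<^sub>F \<epsilon> in at_right 0. \<forall>\<theta>\<in>{Tmin..Tmax}.
        (Cd *v \<eta> l \<theta> + Fd *v 1 - \<gamma> *\<^sub>R 1) + \<epsilon> *\<^sub>R (Cd *v \<xi> \<theta>) <\<^sub>v 0"
      by (rule eventually_vec_less_perturbed[OF _ _ compact_Icc neg(3)])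
        (intro continuous_intros conts)+
    ultimately have "\<forall>\<^sub>F \<epsilon> in at_right 0. 0 < \<epsilon> \<and>
        (\<forall>\<theta>\<in>{Tmin..Tmax}. (J *v \<eta> l \<theta> - l + Ed *v 1) + \<epsilon> *\<^sub>R (J *v \<xi> \<theta> - \<xi> 0) <\<^sub>v 0) \<and>
        (\<forall>\<tau>\<in>{0..Tmax}. (Cc \<tau> *v \<eta> l \<tau> + Fc \<tau> *v 1 - \<gamma> *\<^sub>R 1) + \<epsilon> *\<^sub>R (Cc \<tau> *v \<xi> \<tau>) <\<^sub>v 0) \<and>
        (\<forall>\<theta>\<in>{Tmin..Tmax}. (Cd *v \<eta> l \<theta> + Fd *v 1 - \<gamma> *\<^sub>R 1) + \<epsilon> *\<^sub>R (Cd *v \<xi> \<theta>) <\<^sub>v 0)"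
      using eventually_at_right_less[of "0::real"] by eventually_elim blast
    then obtain \<epsilon> where \<epsilon>: "0 < \<epsilon>"
        "\<forall>\<theta>\<in>{Tmin..Tmax}. (J *v \<eta> l \<theta> - l + Ed *v 1) + \<epsilon> *\<^sub>R (J *v \<xi> \<theta> - \<xi> 0) <\<^sub>v 0"
        "\<forall>\<tau>\<in>{0..Tmax}. (Cc \<tau> *v \<eta> l \<tau> + Fc \<tau> *v 1 - \<gamma> *\<^sub>R 1) + \<epsilon> *\<^sub>R (Cc \<tau> *v \<xi> \<tau>) <\<^sub>v 0"
        "\<forall>\<theta>\<in>{Tmin..Tmax}. (Cd *v \<eta> l \<theta> + Fd *v 1 - \<gamma> *\<^sub>R 1) + \<epsilon> *\<^sub>R (Cd *v \<xi> \<theta>) <\<^sub>v 0"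
      using eventually_happens'[OF trivial_limit_at_right_real] by blast
    define \<zeta> where "\<zeta> s = \<eta> l s + \<epsilon> *\<^sub>R \<xi> s" for s
    have der: "(\<zeta> has_vector_derivative
        A s *v \<eta> l s + u s + \<epsilon> *\<^sub>R (exp (L * s) *\<^sub>R (L *\<^sub>R 1))) (at s within {0..})"
      if "0 \<le> s" for s
      unfolding \<zeta>_def \<xi>_def
      by (intro has_vector_derivative_add der\<eta>[OF that]
          has_vector_derivative_scaleR[OF DERIV_const, simplified] has_vector_derivative_exp_ones)
    have "- vector_derivative \<zeta> (at \<tau> within {0..}) + A \<tau> *v \<zeta> \<tau> + Ec \<tau> *v 1 <\<^sub>v 0"
      if "\<tau> \<in> {0..Tmax}" for \<tau>
    proof -
      have "vector_derivative \<zeta> (at \<tau> within {0..})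
          = A \<tau> *v \<eta> l \<tau> + u \<tau> + \<epsilon> *\<^sub>R (exp (L * \<tau>) *\<^sub>R (L *\<^sub>R 1))"
        using that by (intro vector_derivative_within at_within_atLeast_neq_bot der) auto
      then have "- vector_derivative \<zeta> (at \<tau> within {0..}) + A \<tau> *v \<zeta> \<tau> + Ec \<tau> *v 1
          = - (\<epsilon> *\<^sub>R (exp (L * \<tau>) *\<^sub>R (L *\<^sub>R 1 - A \<tau> *v 1)))"
        by (simp add: \<zeta>_def \<xi>_def u_def matrix_vector_right_distrib matrix_vector_mult_scaleR
            algebra_simps)
      moreover have "0 < \<epsilon> * (exp (L * \<tau>) *\<^sub>R (L *\<^sub>R 1 - A \<tau> *v 1)) $ i" for i
        using L[OF that, of i] \<epsilon>(1) by (intro mult_pos_pos) auto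
      ultimately show ?thesis
        by (simp add: vec_less_def mult.assoc)
    qed
    moreover have "\<zeta> differentiable_on {0..}"
      unfolding differentiable_on_def using der has_vector_derivative_def
      by (metis atLeast_iff differentiable_def)
    moreover have "0 <\<^sub>v \<zeta> 0"
      using l(1) \<epsilon>(1) by (simp add: vec_less_def \<zeta>_def \<eta>0 \<xi>_def add_pos_pos)
    moreover have "J *v \<zeta> \<theta> - \<zeta> 0 + Ed *v 1 <\<^sub>v 0" "Cd *v \<zeta> \<theta> + Fd *v 1 - \<gamma> *\<^sub>R 1 <\<^sub>v 0"
      if "\<theta> \<in> {Tmin..Tmax}" for \<theta>
      using \<epsilon>(2,4) that
      by (auto simp: \<zeta>_def \<eta>0 matrix_vector_right_distrib matrix_vector_mult_scaleR algebra_simps)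
    moreover have "Cc \<tau> *v \<zeta> \<tau> + Fc \<tau> *v 1 - \<gamma> *\<^sub>R 1 <\<^sub>v 0" if "\<tau> \<in> {0..Tmax}" for \<tau>
      using \<epsilon>(3) that
      by (auto simp: \<zeta>_def matrix_vector_right_distrib matrix_vector_mult_scaleR algebra_simps)
    ultimately show ?thesis
      unfolding stmt_b_def by blast
  qed
  moreover have "stmt_a \<and> asymptotically_stable Tmin Tmax A Ec J Ed \<and>
      hybrid_gain Tmin Tmax A Ec Cc Fc J Ed Cd Fd \<le> ereal \<gamma>" if b: "stmt_b"
  proof -
    let ?d = "\<lambda>\<zeta> \<tau>. vector_derivative \<zeta> (at \<tau> within {0..})"
    obtain \<zeta> where diff: "\<zeta> differentiable_on {0..}" and \<zeta>0: "0 <\<^sub>v \<zeta> 0"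
      and flow: "\<And>\<tau>. \<tau> \<in> {0..Tmax} \<Longrightarrow> - ?d \<zeta> \<tau> + A \<tau> *v \<zeta> \<tau> + Ec \<tau> *v 1 <\<^sub>v 0"
      and outc: "\<And>\<tau>. \<tau> \<in> {0..Tmax} \<Longrightarrow> Cc \<tau> *v \<zeta> \<tau> + Fc \<tau> *v 1 - \<gamma> *\<^sub>R 1 <\<^sub>v 0"
      and jump: "\<And>\<theta>. \<theta> \<in> {Tmin..Tmax} \<Longrightarrow> J *v \<zeta> \<theta> - \<zeta> 0 + Ed *v 1 <\<^sub>v 0"
      and outd: "\<And>\<theta>. \<theta> \<in> {Tmin..Tmax} \<Longrightarrow> Cd *v \<zeta> \<theta> + Fd *v 1 - \<gamma> *\<^sub>R 1 <\<^sub>v 0"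
      using b sub(4,5) unfolding stmt_b_def by blast
    have der: "(\<zeta> has_vector_derivative ?d \<zeta> s) (at s within {0..Tmax})" if "s \<in> {0..Tmax}" for s
    proof -
      have "(\<zeta> has_vector_derivative ?d \<zeta> s) (at s within {0..})"
        using diff that unfolding differentiable_on_def vector_derivative_works[symmetric] by auto
      then show ?thesis
        using sub(1) by (rule has_vector_derivative_within_subset)
    qed
    have super: "A s *v \<zeta> s + Ec s *v 1 \<le> ?d \<zeta> s" if "s \<in> {0..Tmax}" for s
      using flow[OF that] by (auto simp: vec_less_def less_eq_vec_def algebra_simps less_imp_le)
    interpret impulsive_supersolution Tmin Tmax A Ec J Ed \<zeta> "?d \<zeta>"
      by unfold_locales
        (use Tmin Tmax continuous_on_subset[OF contA sub(1)] metz nonneg Jn Edn der super in auto)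

    have \<eta>_le: "\<eta> (\<zeta> 0) \<tau> \<le> \<zeta> \<tau>" if "\<tau> \<in> {0..Tmax}" for \<tau>
      unfolding \<eta>_def
      by (rule forced_response_le_supersolution[OF st contA metz contu der])
        (use super that in \<open>auto simp: u_def\<close>)
    have "\<P> (\<zeta> 0)"
      unfolding \<P>_def
    proof (intro ballI conjI)
      fix \<tau> \<theta> assume \<tau>: "\<tau> \<in> {0..Tmax}" and \<theta>: "\<theta> \<in> {Tmin..Tmax}"
      then have \<theta>': "\<theta> \<in> {0..Tmax}"
        using sub(3) by blast
      show "J *v \<eta> (\<zeta> 0) \<theta> - \<zeta> 0 + Ed *v 1 <\<^sub>v 0"
        using matrix_vector_mult_vec_less[OF Jn \<eta>_le[OF \<theta>'], of "- \<zeta> 0 + Ed *v 1"] jump[OF \<theta>] by (simp add: algebra_simps)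
      show "Cc \<tau> *v \<eta> (\<zeta> 0) \<tau> + Fc \<tau> *v 1 - \<gamma> *\<^sub>R 1 <\<^sub>v 0"
        using matrix_vector_mult_vec_less[OF _ \<eta>_le[OF \<tau>], of "Cc \<tau>" "Fc \<tau> *v 1 - \<gamma> *\<^sub>R 1"] nonneg[of \<tau>] outc[OF \<tau>] \<tau>
        by (simp add: algebra_simps)
      show "Cd *v \<eta> (\<zeta> 0) \<theta> + Fd *v 1 - \<gamma> *\<^sub>R 1 <\<^sub>v 0"
        using matrix_vector_mult_vec_less[OF Cdn \<eta>_le[OF \<theta>'], of "Fd *v 1 - \<gamma> *\<^sub>R 1"] outd[OF \<theta>] by (simp add: algebra_simps)
    qed
    then have "stmt_a"
      using a_iff \<zeta>0 by blast

    moreover have "asymptotically_stable Tmin Tmax A Ec J Ed"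
    proof -
      have "J *v \<zeta> \<theta> - \<zeta> 0 <\<^sub>v 0" if "\<theta> \<in> {Tmin..Tmax}" for \<theta>
      proof -
        have "0 \<le> Ed *v 1"
          using matrix_vector_mult_mono[OF Edn, of 0 1] by (simp add: less_eq_vec_def)
        then have "0 \<le> (Ed *v 1) $ i" "(J *v \<zeta> \<theta>) $ i - \<zeta> 0 $ i + (Ed *v 1) $ i < 0" for i
          using jump[OF that] by (auto simp: vec_less_def less_eq_vec_def)
        then show ?thesis
          unfolding vec_less_def vector_minus_component zero_index by (smt (verit))
      qed
      \<comment> \<open>By compactness the strict decrease is uniform in \<open>\<theta>\<close>, which gives the factor \<open>1 - \<epsilon>\<close>.\<close>
      then have "\<forall>\<^sub>F \<epsilon> in at_right 0. \<forall>\<theta>\<in>{Tmin..Tmax}. (J *v \<zeta> \<theta> - \<zeta> 0) + \<epsilon> *\<^sub>R \<zeta> 0 <\<^sub>v 0"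
        by (intro eventually_vec_less_perturbed continuous_intros
            continuous_on_subset[OF continuous_on_supersolution sub(3)]) auto
      moreover have "\<forall>\<^sub>F \<epsilon> in at_right 0. \<epsilon> \<in> {0<..<1::real}"
        by (rule eventually_at_right_real) simp
      ultimately have "\<forall>\<^sub>F \<epsilon> in at_right 0. \<epsilon> \<in> {0<..<1} \<and>
          (\<forall>\<theta>\<in>{Tmin..Tmax}. (J *v \<zeta> \<theta> - \<zeta> 0) + \<epsilon> *\<^sub>R \<zeta> 0 <\<^sub>v 0)"
        by eventually_elim blast
      then obtain \<epsilon> where \<epsilon>: "\<epsilon> \<in> {0<..<1}"
          "\<forall>\<theta>\<in>{Tmin..Tmax}. (J *v \<zeta> \<theta> - \<zeta> 0) + \<epsilon> *\<^sub>R \<zeta> 0 <\<^sub>v 0"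
        using eventually_happens'[OF trivial_limit_at_right_real] by blast
      show ?thesis
        by (rule asymptotic_stability[OF \<zeta>0, of "1 - \<epsilon>"])
          (use \<epsilon> in \<open>auto simp: vec_less_def less_eq_vec_def algebra_simps intro!: less_imp_le\<close>)
    qed
    moreover have "hybrid_gain Tmin Tmax A Ec Cc Fc J Ed Cd Fd \<le> ereal \<gamma>"
    proof (rule hybrid_gain_le)
      show "0 \<le> \<zeta> 0"
        using \<zeta>0 by (auto simp: vec_less_def less_eq_vec_def less_imp_le)
      show "J *v \<zeta> \<theta> + Ed *v 1 \<le> \<zeta> 0" if "\<theta> \<in> {Tmin..Tmax}" for \<theta>
        using jump[OF that] by (auto simp: vec_less_def less_eq_vec_def algebra_simps less_imp_le)
      show "Cc s *v \<zeta> s + Fc s *v 1 \<le> \<gamma> *\<^sub>R 1" if "s \<in> {0..Tmax}" for s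
        using outc[OF that] by (auto simp: vec_less_def less_eq_vec_def algebra_simps less_imp_le)
      show "Cd *v \<zeta> \<theta> + Fd *v 1 \<le> \<gamma> *\<^sub>R 1" if "\<theta> \<in> {Tmin..Tmax}" for \<theta>
        using outd[OF that] by (auto simp: vec_less_def less_eq_vec_def algebra_simps less_imp_le)
    qed (use continuous_on_subset[OF contCc sub(1)] continuous_on_subset[OF contFc sub(1)]
        nonneg Cdn Fdn in auto)
    ultimately show ?thesis
      by blast
  qed
  moreover have "stmt_c" if b: "stmt_b"
  proof -
    obtain \<zeta> where \<zeta>: "\<zeta> differentiable_on {0..}" "0 <\<^sub>v \<zeta> 0"
      "\<forall>\<tau>\<in>{0..Tmax}. \<forall>\<theta>\<in>{Tmin..Tmax}.
        - vector_derivative \<zeta> (at \<tau> within {0..}) + A \<tau> *v \<zeta> \<tau> + Ec \<tau> *v 1 <\<^sub>v 0 \<and>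
        Cc \<tau> *v \<zeta> \<tau> + Fc \<tau> *v 1 - \<gamma> *\<^sub>R 1 <\<^sub>v 0 \<and>
        J *v \<zeta> \<theta> - \<zeta> 0 + Ed *v 1 <\<^sub>v 0 \<and>
        Cd *v \<zeta> \<theta> + Fd *v 1 - \<gamma> *\<^sub>R 1 <\<^sub>v 0"
      using b unfolding stmt_b_def by blast
    then show ?thesis
      unfolding stmt_c_def by (intro exI[of _ \<zeta>]) auto
  qed
  moreover have "stmt_b" if c: "stmt_c"
  proof -
    obtain \<zeta> \<mu> where \<zeta>: "\<zeta> differentiable_on {0..}" "0 <\<^sub>v \<zeta> 0"
      and *: "\<And>\<tau> \<theta>. \<tau> \<in> {0..Tmax} \<Longrightarrow> \<theta> \<in> {Tmin..Tmax} \<Longrightarrow>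
        - vector_derivative \<zeta> (at \<tau> within {0..}) + A \<tau> *v \<zeta> \<tau> + Ec \<tau> *v 1 <\<^sub>v 0 \<and>
        Cc \<tau> *v \<zeta> \<tau> + Fc \<tau> *v 1 - \<gamma> *\<^sub>R 1 <\<^sub>v 0 \<and>
        \<zeta> \<theta> - \<mu> \<theta> \<le> 0 \<and>
        J *v \<mu> \<theta> - \<zeta> 0 + Ed *v 1 <\<^sub>v 0 \<and>
        Cd *v \<mu> \<theta> + Fd *v 1 - \<gamma> *\<^sub>R 1 <\<^sub>v 0"
      using c unfolding stmt_c_def by blast
    have "J *v \<zeta> \<theta> - \<zeta> 0 + Ed *v 1 <\<^sub>v 0 \<and> Cd *v \<zeta> \<theta> + Fd *v 1 - \<gamma> *\<^sub>R 1 <\<^sub>v 0"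
      if "\<theta> \<in> {Tmin..Tmax}" for \<theta>
    proof -
      have le: "\<zeta> \<theta> \<le> \<mu> \<theta>"
        using *[OF sub(4) that] by (simp add: less_eq_vec_def)
      show ?thesis
        using *[OF sub(4) that] matrix_vector_mult_vec_less[OF Jn le, of "- \<zeta> 0 + Ed *v 1"]
          matrix_vector_mult_vec_less[OF Cdn le, of "Fd *v 1 - \<gamma> *\<^sub>R 1"]
        by (simp add: algebra_simps)
    qed
    then show ?thesis
      using \<zeta> * sub(5) unfolding stmt_b_def by blast
  qed
  ultimately show ?thesis
    by blast
qed

end
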